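(* Let $(Q,\lhd)$ be a quandle, $R$ a commutative ring, $A$ an $R$-module, and $\alpha\in R^*$ a unit. Let $\omega,\omega'\colon Q\times Q\to A$ be cohomologous $\alpha$-twisted quandle $2$-cocycles. Then they yield the same weights, i.e. $\mathcal{W}^{tw}_\omega(D,\mathcal{C},\alpha)=\mathcal{W}^{tw}_{\omega'}(D,\mathcal{C},\alpha)$ for every $Q$-colored knot diagram $(D,\mathcal{C})$, and identical twisted quandle cocycle invariants, i.e. for every knot diagram $D$ the multisets $\{\,\mathcal{W}^{tw}_\omega(D,\mathcal{C},\alpha)\mid\mathcal{C}\in\mathscr{C}_Q(D)\,\}$ and $\{\,\mathcal{W}^{tw}_{\omega'}(D,\mathcal{C},\alpha)\mid\mathcal{C}\in\mathscr{C}_Q(D)\,\}$ coincide.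
   Context: Quandle: a set $Q$ with operations $\lhd,\widetilde{\lhd}$ such that $(a\lhd b)\lhd c=(a\lhd c)\lhd(b\lhd c)$, $(a\lhd b)\,\widetilde{\lhd}\,b=(a\,\widetilde{\lhd}\,b)\lhd b=a$, $a\lhd a=a$ for all $a,b,c\in Q$. Knots: "knot" means oriented knot or link in $\mathbb{R}^3$; a knot diagram $D$ is a diagram in $\mathbb{R}^2$ of such a link. Arcs run from undercrossing to undercrossing (or are closed curves). Regions are the connected components of $\mathbb{R}^2\setminus D$; $\Delta_{ex}(D)$ is the exterior (unbounded) region. Left and right of an oriented arc are as seen when travelling along it. A $Q$-coloring $\mathcal{C}$ of $D$ assigns an element of $Q$ to each arc such that at each crossing, if the over-arc has color $b$ and the under-arc on the right of the over-arc has color $a$, then the under-arc on the left of the over-arc has color $a\lhd b$. The set of $Q$-colorings is $\mathscr{C}_Q(D)$. The index $i(\Delta)$ of a region $\Delta$ is the algebraic intersection number of $D$ with a path from $\Delta$ to $\Delta_{ex}(D)$ (finitely many simple transverse intersections), where a crossing of the path over $D$ from the left side to the right side of the oriented $D$ counts $+1$ and from right to left counts $-1$. The source region $\Delta(x)$ of a crossing $x$ is the one of the four regions at $x$ lying on the right of both strands. Put $i(x)=i(\Delta(x))$. The $\alpha$-twisted $\omega$-weight is $\mathcal{W}^{tw}_\omega(D,\mathcal{C},\alpha)=\sum_x\varepsilon(x)\alpha^{-i(x)}\omega(a_x,b_x)$, summed over all crossings, where $\varepsilon(x)=\pm1$ is the usual sign, $b_x$ is the color of the over-arc and $a_x$ the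 color of the under-arc lying on the right of the over-arc. An $\alpha$-twisted quandle $2$-cocycle is a map $\omega\colon Q\times Q\to A$ with $\omega(a,a)=0$ and $\omega(a\lhd c,b\lhd c)-\alpha\omega(a,b)-\omega(a\lhd b,c)+\alpha\omega(a,c)+(1-\alpha)\omega(b,c)=0$ for all $a,b,c$. Two are cohomologous if their difference is of the form $(a,b)\mapsto(1-\alpha)\theta(b)-\theta(a\lhd b)+\alpha\theta(a)$ for some map $\theta\colon Q\to A$. *)

theory Defs
  imports "HOL-Analysis.Analysis" "HOL-Library.Equipollence"
begin

section \<open>Quandles and twisted cocycles\<close>

definition quandle :: "'q set \<Rightarrow> ('q \<Rightarrow> 'q \<Rightarrow> 'q) \<Rightarrow> ('q \<Rightarrow> 'q \<Rightarrow> 'q) \<Rightarrow> bool" where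
  "quandle Q lhd lhd_inv \<longleftrightarrow>
     (\<forall>a\<in>Q. \<forall>b\<in>Q. lhd a b \<in> Q \<and> lhd_inv a b \<in> Q) \<and>
     (\<forall>a\<in>Q. \<forall>b\<in>Q. \<forall>c\<in>Q. lhd (lhd a b) c = lhd (lhd a c) (lhd b c)) \<and>
     (\<forall>a\<in>Q. \<forall>b\<in>Q. lhd_inv (lhd a b) b = a \<and> lhd (lhd_inv a b) b = a) \<and>
     (\<forall>a\<in>Q. lhd a a = a)"

text \<open>In the following two definitions \<open>s\<close> is the scalar multiplication of the module.\<close>

definition twisted_cocycle ::
  "'q set \<Rightarrow> ('q \<Rightarrow> 'q \<Rightarrow> 'q) \<Rightarrow> ('r::comm_ring_1 \<Rightarrow> 'a::ab_group_add \<Rightarrow> 'a) \<Rightarrow> 'r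
     \<Rightarrow> ('q \<Rightarrow> 'q \<Rightarrow> 'a) \<Rightarrow> bool" where
  "twisted_cocycle Q lhd s \<alpha> \<omega> \<longleftrightarrow>
     (\<forall>a\<in>Q. \<omega> a a = 0) \<and>
     (\<forall>a\<in>Q. \<forall>b\<in>Q. \<forall>c\<in>Q.
        \<omega> (lhd a c) (lhd b c) - s \<alpha> (\<omega> a b) - \<omega> (lhd a b) c + s \<alpha> (\<omega> a c)
          + s (1 - \<alpha>) (\<omega> b c) = 0)"

definition cohomologous ::
  "'q set \<Rightarrow> ('q \<Rightarrow> 'q \<Rightarrow> 'q) \<Rightarrow> ('r::comm_ring_1 \<Rightarrow> 'a::ab_group_add \<Rightarrow> 'a) \<Rightarrow> 'r
     \<Rightarrow> ('q \<Rightarrow> 'q \<Rightarrow> 'a) \<Rightarrow> ('q \<Rightarrow> 'q \<Rightarrow> 'a) \<Rightarrow> bool" where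
  "cohomologous Q lhd s \<alpha> \<omega> \<omega>' \<longleftrightarrow>
     (\<exists>\<theta>. \<forall>a\<in>Q. \<forall>b\<in>Q.
        \<omega> a b - \<omega>' a b = s (1 - \<alpha>) (\<theta> b) - \<theta> (lhd a b) + s \<alpha> (\<theta> a))"

definition unit_power_int :: "'r::comm_ring_1 \<Rightarrow> int \<Rightarrow> 'r" where
  "unit_power_int \<alpha> k = (if 0 \<le> k then \<alpha> ^ nat k else (THE \<beta>. \<alpha> * \<beta> = 1) ^ nat (- k))"


section \<open>Oriented knot and link diagrams\<close>

text \<open>
  The plane is the type \<^typ>\<open>complex\<close>. The components \<open>curve D 0, \<dots>, curve D (ncomp D - 1)\<close> are
  closed curves, given as 1-periodic functions on the line and oriented by their parameter.
  A \<^emph>\<open>strand\<close> at a point of the diagram is a pair \<open>(j, t)\<close> of a component and a parameter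
  \<open>t \<in> {0..<1}\<close>; at a crossing \<open>x\<close> the strand \<open>over D x\<close> is the upper one (the value
  elsewhere is irrelevant).
\<close>

record diagram =
  ncomp :: nat
  curve :: "nat \<Rightarrow> real \<Rightarrow> complex"
  over :: "complex \<Rightarrow> nat \<times> real"

definition strands :: "diagram \<Rightarrow> complex \<Rightarrow> (nat \<times> real) set" where
  "strands D z = {(j, t). j < ncomp D \<and> 0 \<le> t \<and> t < 1 \<and> curve D j t = z}"

definition crossings :: "diagram \<Rightarrow> complex set" where
  "crossings D = {x. card (strands D x) = 2}"

definition under :: "diagram \<Rightarrow> complex \<Rightarrow> nat \<times> real" where
  "under D x = (THE p. p \<in> strands D x \<and> p \<noteq> over D x)"

definition tangent :: "diagram \<Rightarrow> nat \<times> real \<Rightarrow> complex" where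
  "tangent D = (\<lambda>(j, t). vector_derivative (curve D j) (at t))"

definition wedge :: "complex \<Rightarrow> complex \<Rightarrow> real" where
  "wedge u v = Re u * Im v - Im u * Re v"

text \<open>The direction \<open>v\<close> points to the right (left) of somebody travelling in direction \<open>u\<close>.\<close>

definition right_of :: "complex \<Rightarrow> complex \<Rightarrow> bool" where
  "right_of u v \<longleftrightarrow> wedge u v < 0"

definition left_of :: "complex \<Rightarrow> complex \<Rightarrow> bool" where
  "left_of u v \<longleftrightarrow> wedge u v > 0"

text \<open>
  Diagrams of smooth links: the components are regular closed \<open>C\<^sup>1\<close> curves whose only
  multiple points are finitely many transverse double points.
\<close>

definition knot_diagram :: "diagram \<Rightarrow> bool" where
  "knot_diagram D \<longleftrightarrow>
     0 < ncomp D \<and>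
     (\<forall>j<ncomp D. curve D j C1_differentiable_on UNIV \<and>
        (\<forall>t. curve D j (t + 1) = curve D j t \<and> vector_derivative (curve D j) (at t) \<noteq> 0)) \<and>
     (\<forall>z. finite (strands D z) \<and> card (strands D z) \<le> 2) \<and>
     finite (crossings D) \<and>
     (\<forall>x\<in>crossings D. over D x \<in> strands D x \<and>
        wedge (tangent D (over D x)) (tangent D (under D x)) \<noteq> 0)"

text \<open>Positive means: turning the over-strand counterclockwise by less than \<open>\<pi>\<close> gives the
  under-strand.\<close>

definition crossing_sign :: "diagram \<Rightarrow> complex \<Rightarrow> int" where
  "crossing_sign D x =
     (if wedge (tangent D (over D x)) (tangent D (under D x)) > 0 then 1 else - 1)"


section \<open>Arcs and colorings\<close>

definition under_params :: "diagram \<Rightarrow> nat \<Rightarrow> real set" where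
  "under_params D j =
     {t. curve D j t \<in> crossings D \<and> (j, frac t) = under D (curve D j t)}"

text \<open>
  An arc is represented by the pairs \<open>(j, s)\<close> with \<open>s\<close> a parameter of a point of the arc
  (undercrossings at its ends excluded). The parameters form a periodic subset of the line, so
  that they may be compared with parameters just before or after any given one. A component
  without undercrossing is a single arc.
\<close>

type_synonym arc = "(nat \<times> real) set"

definition arc_through :: "diagram \<Rightarrow> nat \<Rightarrow> real \<Rightarrow> arc" where
  "arc_through D j t =
     {(j, s) | s. \<exists>k::int. connected_component (- under_params D j) t (s + of_int k)}"

definition arcs :: "diagram \<Rightarrow> arc set" where
  "arcs D = {arc_through D j t | j t. j < ncomp D \<and> t \<notin> under_params D j}"

definition over_arc :: "diagram \<Rightarrow> complex \<Rightarrow> arc" where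
  "over_arc D x = (THE a. a \<in> arcs D \<and> over D x \<in> a)"

definition incoming_under_arc :: "diagram \<Rightarrow> complex \<Rightarrow> arc" where
  "incoming_under_arc D x =
     (case under D x of (j, t) \<Rightarrow> THE a. a \<in> arcs D \<and> (\<forall>\<^sub>F s in at_left t. (j, s) \<in> a))"

definition outgoing_under_arc :: "diagram \<Rightarrow> complex \<Rightarrow> arc" where
  "outgoing_under_arc D x =
     (case under D x of (j, t) \<Rightarrow> THE a. a \<in> arcs D \<and> (\<forall>\<^sub>F s in at_right t. (j, s) \<in> a))"

text \<open>Seen from the crossing, the incoming under-arc lies in the direction opposite to the tangent
  of the under-strand, the outgoing one in the direction of this tangent.\<close>

definition right_under_arc :: "diagram \<Rightarrow> complex \<Rightarrow> arc" where
  "right_under_arc D x =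
     (if right_of (tangent D (over D x)) (- tangent D (under D x))
      then incoming_under_arc D x else outgoing_under_arc D x)"

definition left_under_arc :: "diagram \<Rightarrow> complex \<Rightarrow> arc" where
  "left_under_arc D x =
     (if left_of (tangent D (over D x)) (- tangent D (under D x))
      then incoming_under_arc D x else outgoing_under_arc D x)"

definition colorings :: "'q set \<Rightarrow> ('q \<Rightarrow> 'q \<Rightarrow> 'q) \<Rightarrow> diagram \<Rightarrow> (arc \<Rightarrow> 'q) set" where
  "colorings Q lhd D =
     {C \<in> arcs D \<rightarrow>\<^sub>E Q. \<forall>x\<in>crossings D.
        C (left_under_arc D x) = lhd (C (right_under_arc D x)) (C (over_arc D x))}"


section \<open>Regions and their index\<close>

definition support :: "diagram \<Rightarrow> complex set" where
  "support D = (\<Union>j<ncomp D. range (curve D j))"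

definition regions :: "diagram \<Rightarrow> complex set set" where
  "regions D = components (- support D)"

definition exterior_region :: "diagram \<Rightarrow> complex set" where
  "exterior_region D = (THE \<Delta>. \<Delta> \<in> regions D \<and> \<not> bounded \<Delta>)"

definition hits :: "diagram \<Rightarrow> (real \<Rightarrow> complex) \<Rightarrow> real set" where
  "hits D p = {s \<in> {0..1}. p s \<in> support D}"

text \<open>The tangent of the diagram at a point of its support that is not a crossing.\<close>

definition tangent_at :: "diagram \<Rightarrow> complex \<Rightarrow> complex" where
  "tangent_at D z = tangent D (the_elem (strands D z))"

definition transverse_path ::
  "diagram \<Rightarrow> complex set \<Rightarrow> complex set \<Rightarrow> (real \<Rightarrow> complex) \<Rightarrow> bool" where
  "transverse_path D \<Delta> \<Delta>' p \<longleftrightarrow>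
     path p \<and> pathstart p \<in> \<Delta> \<and> pathfinish p \<in> \<Delta>' \<and> finite (hits D p) \<and>
     (\<forall>s\<in>hits D p. p s \<notin> crossings D \<and> p differentiable (at s) \<and>
        wedge (tangent_at D (p s)) (vector_derivative p (at s)) \<noteq> 0)"

text \<open>Passing from the left to the right of the diagram counts \<open>+1\<close>.\<close>

definition intersection_number :: "diagram \<Rightarrow> (real \<Rightarrow> complex) \<Rightarrow> int" where
  "intersection_number D p =
     (\<Sum>s\<in>hits D p.
        if right_of (tangent_at D (p s)) (vector_derivative p (at s)) then 1 else - 1)"

definition index :: "diagram \<Rightarrow> complex set \<Rightarrow> int" where
  "index D \<Delta> =
     (THE n. \<exists>p. transverse_path D \<Delta> (exterior_region D) p \<and> intersection_number D p = n)"

text \<open>The source region contains the initial pieces of all rays from the crossing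
  that point to the right of both strands.\<close>

definition source_region :: "diagram \<Rightarrow> complex \<Rightarrow> complex set" where
  "source_region D x =
     (THE \<Delta>. \<Delta> \<in> regions D \<and>
        (\<forall>w. right_of (tangent D (over D x)) w \<and> right_of (tangent D (under D x)) w \<longrightarrow>
             (\<forall>\<^sub>F r in at_right 0. x + complex_of_real r * w \<in> \<Delta>)))"

definition crossing_index :: "diagram \<Rightarrow> complex \<Rightarrow> int" where
  "crossing_index D x = index D (source_region D x)"


section \<open>Weights\<close>

definition twisted_weight ::
  "('r::comm_ring_1 \<Rightarrow> 'a::ab_group_add \<Rightarrow> 'a) \<Rightarrow> ('q \<Rightarrow> 'q \<Rightarrow> 'a) \<Rightarrow> diagram \<Rightarrow> (arc \<Rightarrow> 'q) \<Rightarrow> 'r \<Rightarrow> 'a"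
  where
  "twisted_weight s \<omega> D C \<alpha> =
     (\<Sum>x\<in>crossings D.
        s (of_int (crossing_sign D x) * unit_power_int \<alpha> (- crossing_index D x))
          (\<omega> (C (right_under_arc D x)) (C (over_arc D x))))"

text \<open>
  Equality of the multisets \<open>{f i | i \<in> I}\<close> and \<open>{g i | i \<in> J}\<close>. The quandle, and hence the
  set of colorings, may be infinite, so multiplicities are compared as cardinalities.
\<close>

definition same_multiset :: "'i set \<Rightarrow> ('i \<Rightarrow> 'a) \<Rightarrow> 'j set \<Rightarrow> ('j \<Rightarrow> 'a) \<Rightarrow> bool" where
  "same_multiset I f J g \<longleftrightarrow> (\<forall>w. {i \<in> I. f i = w} \<approx> {j \<in> J. g j = w})"

end

(* The index of a region is the sum of the winding numbers of the components around its points: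
   this sum is locally constant off the diagram, vanishes far away, and is larger by one on the
   left of a strand than on its right.

   Along a component, give the point with colour c and index k of the region on its right the
   value alpha^(1 - k) * theta(c). This is locally constant between crossings. Let n be the index
   of the source region of a crossing x, a and b the colours of the right under-arc and of the
   over-arc. The right-hand index of either strand is n on the right of the other strand and n + 1
   on its left, so the values just before x minus those just after x, summed over the two strands,
   give epsilon(x) * alpha^(-n) * ((1 - alpha) theta(b) - theta(a <| b) + alpha theta(a)), which
   is the difference of the contributions of x to the two weights. Each component being closed,
   the total is zero. *)

theory Submission
  imports Defs "HOL-Complex_Analysis.Complex_Analysis"
begin


section \<open>Planar determinants\<close>

text \<open>Both \<open>index\<close> and \<open>source_region\<close> are definite descriptions, so
  neither has a known value before existence and uniqueness are settled. Winding numbers give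
  uniqueness: all transverse paths from a region to the exterior have the same intersection number.
  Existence of such a path needs Sard's theorem, since an arbitrary path may touch the diagram
  tangentially or meet it infinitely often.

  No normal form of a crossing is used. Each strand is compared with its tangent line by first-order
  estimates that are uniform over a compact set of directions, and a region touching a point
  \<open>x\<close> is addressed by a direction at \<open>x\<close> transverse to all strands there.
  The delicate point is to relate the regions seen from \<open>x\<close> to those seen from nearby
  points of a strand. At a crossing the sides of a strand are probed with multiples of the other
  tangent rather than with the normal: turning from the strand towards its normal could sweep across
  the other strand, while turning towards the other tangent stays within one sector.\<close>

lemma wedge_eq_Im: "wedge u v = Im (cnj u * v)"
  by (simp add: wedge_def)

lemma wedge_simps [simp]:
  "wedge u u = 0" "wedge u 0 = 0" "wedge 0 v = 0"
  "wedge (- u) v = - wedge u v" "wedge u (- v) = - wedge u v"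
  "wedge (of_real r * u) v = r * wedge u v" "wedge u (of_real r * v) = r * wedge u v"
  by (simp_all add: wedge_def algebra_simps)

lemma wedge_add_right: "wedge u (v + v') = wedge u v + wedge u v'"
  by (simp_all add: wedge_def algebra_simps)

lemma wedge_commute: "wedge u v = - wedge v u"
  by (simp add: wedge_def)

lemma abs_wedge_le: "\<bar>wedge u v\<bar> \<le> norm u * norm v"
  unfolding wedge_eq_Im using abs_Im_le_cmod[of "cnj u * v"] by (simp add: norm_mult)

lemma continuous_on_wedge [continuous_intros]:
  "continuous_on S f \<Longrightarrow> continuous_on S g \<Longrightarrow> continuous_on S (\<lambda>x. wedge (f x) (g x))"
  unfolding wedge_def by (intro continuous_intros)

text \<open>Multiplication by \<i> turns a tangent into its left normal, so \<open>\<i> * u\<close>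
  and \<open>- (\<i> * u)\<close> serve as standard directions to the left and to the right of a
  strand.\<close>

lemma wedge_perp: "wedge u (\<i> * u) = (norm u)\<^sup>2"
  unfolding cmod_power2 by (simp add: wedge_def power2_eq_square)


section \<open>Local geometry of a diagram\<close>

locale link_diagram =
  fixes D :: diagram
  assumes knot_diagram: "knot_diagram D"
begin

section \<open>Periodicity of the components and compactness of the diagram\<close>

lemma C1_curve: "j < ncomp D \<Longrightarrow> curve D j C1_differentiable_on UNIV"
  and curve_add_1: "j < ncomp D \<Longrightarrow> curve D j (t + 1) = curve D j t"
  and tangent_nz: "j < ncomp D \<Longrightarrow> tangent D (j, t) \<noteq> 0"
  and finite_strands: "finite (strands D z)"
  and card_strands_le: "card (strands D z) \<le> 2"
  and finite_crossings: "finite (crossings D)"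
  and over_in_strands: "x \<in> crossings D \<Longrightarrow> over D x \<in> strands D x"
  and wedge_over_under:
    "x \<in> crossings D \<Longrightarrow> wedge (tangent D (over D x)) (tangent D (under D x)) \<noteq> 0"
  using knot_diagram by (auto simp: knot_diagram_def tangent_def)

lemma curve_add_int: assumes "j < ncomp D" shows "curve D j (t + of_int k) = curve D j t"
proof -
  have nat: "curve D j (t + of_nat n) = curve D j t" for t n
  proof (induction n)
    case (Suc n)
    then show ?case using curve_add_1[OF assms, of "t + of_nat n"] by (simp add: algebra_simps)
  qed simp
  show ?thesis
  proof (cases "k \<ge> 0")
    case True
    then show ?thesis using nat[of t "nat k"] by simp
  next
    case False
    then show ?thesis using nat[of "t + of_int k" "nat (- k)"] by simp
  qed
qed

lemma has_vector_derivative_curve: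
  "j < ncomp D \<Longrightarrow> (curve D j has_vector_derivative tangent D (j, t)) (at t)"
  using C1_curve[of j] by (auto simp: C1_differentiable_on_eq tangent_def vector_derivative_works)

lemma continuous_on_tangent: "j < ncomp D \<Longrightarrow> continuous_on UNIV (\<lambda>t. tangent D (j, t))"
  using C1_curve[of j] by (auto simp: C1_differentiable_on_eq tangent_def)

lemma continuous_on_curve: "j < ncomp D \<Longrightarrow> continuous_on A (curve D j)"
  by (meson C1_curve C1_differentiable_imp_continuous_on continuous_on_subset subset_UNIV)

lemma tangent_add_int: assumes "j < ncomp D" shows "tangent D (j, t + of_int k) = tangent D (j, t)"
proof -
  have "((\<lambda>s. curve D j (s + of_int k)) has_vector_derivative tangent D (j, t + of_int k)) (at t)"
    using vector_diff_chain_at[of "\<lambda>s. s + of_int k" 1 t "curve D j" "tangent D (j, t + of_int k)"]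
      has_vector_derivative_curve[OF assms] by (simp add: o_def has_vector_derivative_add_const)
  then have "(curve D j has_vector_derivative tangent D (j, t + of_int k)) (at t)"
    by (simp add: curve_add_int[OF assms])
  with has_vector_derivative_curve[OF assms] show ?thesis
    using vector_derivative_unique_at by blast
qed

lemma curve_frac: "j < ncomp D \<Longrightarrow> curve D j (frac t) = curve D j t"
  using curve_add_int[of j t "- \<lfloor>t\<rfloor>"] by (simp add: frac_def)

lemma tangent_frac: "j < ncomp D \<Longrightarrow> tangent D (j, frac t) = tangent D (j, t)"
  using tangent_add_int[of j t "- \<lfloor>t\<rfloor>"] by (simp add: frac_def)

lemma strandsI: "j < ncomp D \<Longrightarrow> (j, frac t) \<in> strands D (curve D j t)"
  by (auto simp: strands_def curve_frac frac_lt_1)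

lemma strandsD:
  assumes "(j, t) \<in> strands D x" shows "j < ncomp D" "0 \<le> t" "t < 1" "curve D j t = x"
  using assms by (auto simp: strands_def)

lemma support_iff: "z \<in> support D \<longleftrightarrow> strands D z \<noteq> {}"
proof
  assume "z \<in> support D"
  then show "strands D z \<noteq> {}" using strandsI by (force simp: support_def)
qed (auto simp: support_def strands_def)

lemma range_curve: "j < ncomp D \<Longrightarrow> range (curve D j) = curve D j ` {0..1}"
proof -
  assume j: "j < ncomp D"
  have "curve D j t \<in> curve D j ` {0..1}" for t
    using curve_frac[OF j, of t] frac_lt_1[of t] frac_ge_0[of t]
    by (metis atLeastAtMost_iff image_eqI less_imp_le)
  then show ?thesis by auto
qed

lemma compact_support: "compact (support D)"
  unfolding support_def
  by (intro compact_UN) (auto simp: range_curve intro!: compact_continuous_image continuous_on_curve)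

lemma open_compl_support: "open (- support D)"
  using compact_support compact_imp_closed by auto

text \<open>Continuity of the derivative makes the curve minus its linear part at \<open>t0\<close>
  Lipschitz with small constant near \<open>t0\<close>. The two-point form is needed later to
  compare two nearby points of one strand, neither of them at \<open>t0\<close>.\<close>

lemma strict_derivative:
  assumes "j < ncomp D" "e > 0"
  shows "\<exists>d>0. \<forall>s t. \<bar>s - t0\<bar> < d \<longrightarrow> \<bar>t - t0\<bar> < d \<longrightarrow>
    norm (curve D j s - curve D j t - of_real (s - t) * tangent D (j, t0)) \<le> e * \<bar>s - t\<bar>"
proof -
  have "isCont (\<lambda>t. tangent D (j, t)) t0"
    using continuous_on_tangent[OF assms(1)] by (simp add: continuous_on_eq_continuous_at)
  then obtain d where d: "d > 0" "\<And>t. dist t t0 < d \<Longrightarrow> dist (tangent D (j, t)) (tangent D (j, t0)) < e"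
    using assms(2) unfolding continuous_at_eps_delta by blast
  let ?g = "\<lambda>t. curve D j t - of_real t * tangent D (j, t0)"
  have "norm (?g s - ?g t) \<le> e * norm (s - t)" if "\<bar>s - t0\<bar> < d" "\<bar>t - t0\<bar> < d" for s t
  proof (rule differentiable_bound[of "ball t0 d"])
    fix t assume "t \<in> ball t0 d"
    have "(?g has_vector_derivative tangent D (j, t) - tangent D (j, t0)) (at t)"
      by (rule derivative_eq_intros has_vector_derivative_curve assms refl)+
         (simp_all add: has_vector_derivative_of_real)
    then show "(?g has_derivative (\<lambda>h. h *\<^sub>R (tangent D (j, t) - tangent D (j, t0)))) (at t within ball t0 d)"
      using has_vector_derivative_at_within has_vector_derivative_def by blast
    have "norm (tangent D (j, t) - tangent D (j, t0)) \<le> e"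
      using d(2)[of t] \<open>t \<in> _\<close> by (auto simp: dist_real_def dist_norm abs_minus_commute norm_minus_commute)
    then show "onorm (\<lambda>h. h *\<^sub>R (tangent D (j, t) - tangent D (j, t0))) \<le> e"
      by (intro onorm_le) (simp add: mult.commute[of e] mult_left_mono)
  qed (use that in \<open>auto simp: dist_real_def\<close>)
  then show ?thesis using d(1) by (auto simp: algebra_simps intro!: exI[of _ d])
qed

text \<open>Parameters that stay away from all strands at \<open>x\<close> form a compact set, whose
  image is closed and misses \<open>x\<close>. If \<open>x\<close> is off the diagram there are no
  strands, and the lemma says that no point of the diagram is near \<open>x\<close>.\<close>

lemma near_strand:
  assumes "e > 0"
  shows "\<exists>\<delta>>0. \<forall>z\<in>support D. dist z x < \<delta> \<longrightarrow>
    (\<exists>j t0 t. (j, t0) \<in> strands D x \<and> \<bar>t - t0\<bar> < e \<and> curve D j t = z)"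
proof -
  \<comment> \<open>All integer translates are removed, since a parameter near 1 may belong to a
    strand with parameter 0.\<close>
  define T where "T j = {0..1} - (\<Union>t0\<in>{t0. (j, t0) \<in> strands D x}. \<Union>k::int. ball (t0 + of_int k) e)" for j
  let ?F = "\<Union>j<ncomp D. curve D j ` T j"
  have cT: "compact (T j)" for j
    unfolding T_def by (intro compact_diff open_UN ballI open_ball compact_Icc)
  have "closed ?F"
    by (intro compact_imp_closed compact_UN compact_continuous_image continuous_on_curve cT) auto
  moreover have "x \<notin> ?F"
  proof
    assume "x \<in> ?F"
    then obtain j t where j: "j < ncomp D" "t \<in> T j" "curve D j t = x" by auto
    then have "(j, frac t) \<in> strands D x" using strandsI by blast
    moreover have "t \<in> ball (frac t + of_int \<lfloor>t\<rfloor>) e" using assms by (simp add: frac_def)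
    ultimately show False using j(2) unfolding T_def by blast
  qed
  ultimately have "open (- ?F)" "x \<in> - ?F" using open_Compl by blast+
  then obtain \<delta> where \<delta>: "\<delta> > 0" "ball x \<delta> \<subseteq> - ?F"
    by (rule openE)
  have "\<exists>j t0 t. (j, t0) \<in> strands D x \<and> \<bar>t - t0\<bar> < e \<and> curve D j t = z"
    if z: "z \<in> support D" "dist z x < \<delta>" for z
  proof -
    obtain j t where jt: "(j, t) \<in> strands D z" using z(1) support_iff by auto
    note jt' = strandsD[OF jt]
    have "z \<notin> ?F" using \<delta>(2) z(2) by (auto simp only: mem_ball dist_commute subset_iff Compl_iff)
    then have "t \<notin> T j" using jt' by blast
    then obtain t0 k where t0: "(j, t0) \<in> strands D x" "t \<in> ball (t0 + of_int k) e"
      using jt' unfolding T_def by auto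
    then show ?thesis using curve_add_int[OF jt'(1), of t "- k"] jt'(4)
      by (intro exI[of _ j] exI[of _ t0] exI[of _ "t - of_int k"]) (auto simp: dist_real_def)
  qed
  then show ?thesis using \<delta>(1) by blast
qed

text \<open>Close to \<open>t0\<close> the strand lies in a thin double cone around its tangent
  line, while the directions in the compact set \<open>K\<close> keep a positive distance from that
  line.\<close>

lemma strand_avoids_cone:
  assumes p: "(j, t0) \<in> strands D x" and K: "compact K"
    and nz: "\<And>v. v \<in> K \<Longrightarrow> wedge (tangent D (j, t0)) v \<noteq> 0"
  shows "\<exists>e>0. \<forall>t r v. \<bar>t - t0\<bar> < e \<longrightarrow> r > 0 \<longrightarrow> v \<in> K \<longrightarrow> curve D j t \<noteq> x + of_real r * v"
proof (cases "K = {}")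
  case True
  then show ?thesis by (auto intro: exI[of _ 1])
next
  case False
  define u where "u = tangent D (j, t0)"
  note j = strandsD[OF p]
  have "continuous_on K (\<lambda>v. \<bar>wedge u v\<bar>)" by (intro continuous_intros)
  then obtain v0 where v0: "v0 \<in> K" "\<And>v. v \<in> K \<Longrightarrow> \<bar>wedge u v0\<bar> \<le> \<bar>wedge u v\<bar>"
    using continuous_attains_inf[OF K False] by blast
  define m where "m = \<bar>wedge u v0\<bar>"
  have m: "m > 0" using nz[OF v0(1)] by (simp add: m_def u_def)
  obtain B where B: "B > 0" "\<And>v. v \<in> K \<Longrightarrow> norm v \<le> B"
    using compact_imp_bounded[OF K] bounded_pos by blast
  \<comment> \<open>The constant is chosen so that the wedge of the linearisation error with any
    \<open>v\<close> in \<open>K\<close> is at most half of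
    \<open>m * \<bar>t - t0\<bar>\<close>.\<close>
  obtain e where e: "e > 0" "\<And>s t. \<bar>s - t0\<bar> < e \<Longrightarrow> \<bar>t - t0\<bar> < e \<Longrightarrow>
      norm (curve D j s - curve D j t - of_real (s - t) * u) \<le> m / (2 * B) * \<bar>s - t\<bar>"
    using strict_derivative[OF j(1), of "m / (2 * B)" t0] m B(1) unfolding u_def by (metis divide_pos_pos mult_pos_pos zero_less_numeral)
  have False if h: "\<bar>t - t0\<bar> < e" "r > 0" "v \<in> K" "curve D j t = x + of_real r * v" for t r v
  proof -
    \<comment> \<open>At a common point this is the linearisation error of the strand. Wedging with
      \<open>v\<close> removes the term \<open>of_real r * v\<close> and leaves only the
      displacement along \<open>u\<close>.\<close>
    define w where "w = of_real r * v - of_real (t - t0) * u"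
    have w: "norm w \<le> m / (2 * B) * \<bar>t - t0\<bar>"
      using e(2)[of t t0] h e(1) j(4) by (simp add: w_def)
    have "wedge w v = - (t - t0) * wedge u v"
      by (simp add: w_def wedge_def algebra_simps)
    then have "\<bar>t - t0\<bar> * \<bar>wedge u v\<bar> = \<bar>wedge w v\<bar>"
      by (simp only: abs_mult abs_minus_cancel)
    also have "\<dots> \<le> norm w * norm v" by (rule abs_wedge_le)
    also have "\<dots> \<le> (m / (2 * B) * \<bar>t - t0\<bar>) * B"
      using w B(2)[OF h(3)] order_trans[OF norm_ge_zero w] by (intro mult_mono) auto
    also have "\<dots> = \<bar>t - t0\<bar> * (m / 2)" using B(1) by simp
    finally have 1: "\<bar>t - t0\<bar> * \<bar>wedge u v\<bar> \<le> \<bar>t - t0\<bar> * (m / 2)" .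
    have "\<bar>wedge u v\<bar> > m / 2" using v0(2)[OF h(3)] m by (simp add: m_def)
    then have "t = t0" using 1 by (smt (verit) mult_le_cancel_left_pos)
    then have "of_real r * v = 0" using h(4) j(4) by simp
    then have "v = 0" using h(2) by simp
    then show False using nz[OF h(3)] by simp
  qed
  then show ?thesis using e(1) by blast
qed

lemma support_avoids_cone:
  assumes K: "compact K"
    and nz: "\<And>p v. p \<in> strands D x \<Longrightarrow> v \<in> K \<Longrightarrow> wedge (tangent D p) v \<noteq> 0"
  shows "\<exists>\<delta>>0. \<forall>v\<in>K. \<forall>r. 0 < r \<and> r < \<delta> \<longrightarrow> x + of_real r * v \<notin> support D"
proof -
  have "\<exists>e>0. \<forall>t r v. \<bar>t - snd p\<bar> < e \<longrightarrow> r > 0 \<longrightarrow> v \<in> K \<longrightarrow> curve D (fst p) t \<noteq> x + of_real r * v"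
    if "p \<in> strands D x" for p
    using strand_avoids_cone[of "fst p" "snd p" x K] that K nz by auto
  then obtain E where E: "\<And>p. p \<in> strands D x \<Longrightarrow> E p > 0"
    "\<And>p t r v. p \<in> strands D x \<Longrightarrow> \<bar>t - snd p\<bar> < E p \<Longrightarrow> r > 0 \<Longrightarrow> v \<in> K \<Longrightarrow>
       curve D (fst p) t \<noteq> x + of_real r * v" by metis
  \<comment> \<open>The extra 1 gives the minimum a value when no strand passes through
    \<open>x\<close>.\<close>
  define e where "e = Min (insert 1 (E ` strands D x))"
  have e: "e > 0" "\<And>p. p \<in> strands D x \<Longrightarrow> e \<le> E p"
    unfolding e_def using finite_strands E(1) by auto
  obtain \<delta> where \<delta>: "\<delta> > 0" "\<And>z. z \<in> support D \<Longrightarrow> dist z x < \<delta> \<Longrightarrow>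
      \<exists>j t0 t. (j, t0) \<in> strands D x \<and> \<bar>t - t0\<bar> < e \<and> curve D j t = z"
    using near_strand[OF e(1)] by blast
  obtain B where B: "B > 0" "\<And>v. v \<in> K \<Longrightarrow> norm v \<le> B"
    using compact_imp_bounded[OF K] bounded_pos by blast
  show ?thesis
  proof (intro exI[of _ "\<delta> / B"] conjI ballI allI impI notI)
    fix v r assume h: "v \<in> K" "0 < r \<and> r < \<delta> / B" "x + of_real r * v \<in> support D"
    have "dist (x + of_real r * v) x = r * norm v" using h(2) by (simp add: dist_norm norm_mult)
    also have "\<dots> \<le> r * B" using B(2)[OF h(1)] h(2) by simp
    also have "\<dots> < \<delta>" using h(2) B(1) by (simp add: field_simps)
    finally obtain j t0 t where "(j, t0) \<in> strands D x" "\<bar>t - t0\<bar> < e" "curve D j t = x + of_real r * v"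
      using \<delta>(2)[OF h(3)] by blast
    then show False using E(2)[of "(j, t0)" t r v] e(2)[of "(j, t0)"] h by auto
  qed (use \<delta> B in auto)
qed

text \<open>A truncated cone over a connected set of transverse directions is a continuous image of
  a connected product and avoids the diagram, so all short rays in it enter the same region.\<close>

lemma germ_connected:
  assumes K: "compact K" "connected K"
    and nz: "\<And>p v. p \<in> strands D x \<Longrightarrow> v \<in> K \<Longrightarrow> wedge (tangent D p) v \<noteq> 0"
  shows "\<exists>\<delta>>0. \<forall>v\<in>K. \<forall>w\<in>K. \<forall>r r'. 0 < r \<and> r < \<delta> \<and> 0 < r' \<and> r' < \<delta> \<longrightarrow>
    connected_component (- support D) (x + of_real r * v) (x + of_real r' * w)"
proof -
  obtain \<delta> where \<delta>: "\<delta> > 0" "\<And>v r. v \<in> K \<Longrightarrow> 0 < r \<Longrightarrow> r < \<delta> \<Longrightarrow> x + of_real r * v \<notin> support D"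
    using support_avoids_cone[OF K(1) nz] by blast
  let ?C = "(\<lambda>(r, v). x + of_real r * v) ` ({0<..<\<delta>} \<times> K)"
  have "connected ?C"
    by (intro connected_continuous_image connected_Times K connected_Ioo)
       (auto simp: case_prod_unfold intro!: continuous_intros)
  moreover have "?C \<subseteq> - support D" using \<delta> by auto
  ultimately have "connected_component (- support D) a b" if "a \<in> ?C" "b \<in> ?C" for a b
    using that unfolding connected_component_def by blast
  then show ?thesis using \<delta>(1) by (intro exI[of _ \<delta>]) force
qed

text \<open>Transversality to finitely many strands is an open condition, so a small closed ball of
  directions can serve as the cone. This absorbs the error made when a curve leaves \<open>x\<close>
  in direction \<open>w\<close> only to first order.\<close>

lemma germ_near:
  assumes nz: "\<And>p. p \<in> strands D x \<Longrightarrow> wedge (tangent D p) w \<noteq> 0"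
  shows "\<exists>\<delta>>0. \<forall>v r r'. norm (v - w) < \<delta> \<and> 0 < r \<and> r < \<delta> \<and> 0 < r' \<and> r' < \<delta> \<longrightarrow>
    connected_component (- support D) (x + of_real r * v) (x + of_real r' * w)"
proof -
  let ?U = "\<Inter>p\<in>strands D x. {v. wedge (tangent D p) v \<noteq> 0}"
  have "open ?U"
    using finite_strands by (intro open_INT ballI open_Collect_neq continuous_intros) auto
  moreover have "w \<in> ?U" using nz by auto
  ultimately obtain \<eta> where \<eta>: "\<eta> > 0" "cball w \<eta> \<subseteq> ?U" using open_contains_cball by blast
  have "wedge (tangent D p) v \<noteq> 0" if "p \<in> strands D x" "v \<in> cball w \<eta>" for p v
    using \<eta> that by blast
  then obtain \<delta> where \<delta>: "\<delta> > 0" "\<And>v r r'. v \<in> cball w \<eta> \<Longrightarrow> 0 < r \<Longrightarrow> r < \<delta> \<Longrightarrow> 0 < r' \<Longrightarrow> r' < \<delta> \<Longrightarrow>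
     connected_component (- support D) (x + of_real r * v) (x + of_real r' * w)"
    using germ_connected[of "cball w \<eta>" x] \<eta>(1) by auto
  show ?thesis
    using \<delta> \<eta>(1) by (intro exI[of _ "min \<delta> \<eta>"]) (auto simp: dist_norm norm_minus_commute)
qed

text \<open>The case \<open>\<sigma> = 1\<close> concerns the points of the strand just after \<open>x\<close>, \<open>\<sigma> = - 1\<close> those just before.\<close>

lemma strand_push_off:
  assumes p: "(j, t0) \<in> strands D x" and \<sigma>: "\<bar>\<sigma>\<bar> = 1"
    and V: "wedge (tangent D (j, t0)) V \<noteq> 0"
    and other: "\<And>p \<tau>. p \<in> strands D x \<Longrightarrow> p \<noteq> (j, t0) \<Longrightarrow> 0 \<le> \<tau> \<Longrightarrow> \<tau> \<le> 1 \<Longrightarrow>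
        wedge (tangent D p) (of_real \<sigma> * tangent D (j, t0) + of_real \<tau> * V) \<noteq> 0"
  shows "\<exists>\<delta>>0. \<forall>h \<tau>. 0 < h \<and> h < \<delta> \<and> 0 < \<tau> \<and> \<tau> \<le> 1 \<longrightarrow>
        curve D j (t0 + \<sigma> * h) + of_real (\<tau> * h) * V \<notin> support D"
proof -
  define u where "u = tangent D (j, t0)"
  note j = strandsD[OF p]
  define P where "P = strands D x - {(j, t0)}"
  \<comment> \<open>To first order the pushed-off point is x + h (\<sigma> u + \<tau> V), so these
    are its limiting directions from \<open>x\<close>. The thickened set \<open>K\<close> below
    leaves room for the error.\<close>
  define K0 where "K0 = (\<lambda>\<tau>. of_real \<sigma> * u + of_real \<tau> * V) ` {0..1}"
  let ?U = "\<Inter>p\<in>P. {v. wedge (tangent D p) v \<noteq> 0}"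
  have finP: "finite P" using finite_strands by (simp add: P_def)
  have cK0: "compact K0" unfolding K0_def by (intro compact_continuous_image continuous_intros) auto
  have "open ?U" using finP by (intro open_INT ballI open_Collect_neq continuous_intros) auto
  moreover have "K0 \<subseteq> ?U" using other by (fastforce simp: K0_def P_def u_def)
  ultimately obtain \<eta> where \<eta>: "\<eta> > 0" "(\<Union>v\<in>K0. ball v \<eta>) \<subseteq> ?U"
    using compact_subset_open_imp_ball_epsilon_subset[OF cK0] by blast
  define K where "K = {a + b | a b. a \<in> K0 \<and> b \<in> cball 0 (\<eta> / 2)}"
  have cK: "compact K" unfolding K_def by (intro compact_sums cK0 compact_cball)
  have nzK: "wedge (tangent D p) v \<noteq> 0" if "p \<in> P" "v \<in> K" for p v
  proof -
    obtain a b where "v = a + b" "a \<in> K0" "norm b \<le> \<eta> / 2" using \<open>v \<in> K\<close> by (auto simp: K_def)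
    then have "v \<in> ball a \<eta>" using \<eta>(1) by (simp add: dist_norm)
    then have "v \<in> ?U" using \<eta>(2) \<open>a \<in> K0\<close> by blast
    then show ?thesis using that by blast
  qed
  have "\<exists>e>0. \<forall>t r v. \<bar>t - snd p\<bar> < e \<longrightarrow> r > 0 \<longrightarrow> v \<in> K \<longrightarrow> curve D (fst p) t \<noteq> x + of_real r * v"
    if "p \<in> P" for p
    using strand_avoids_cone[of "fst p" "snd p" x K] that cK nzK by (auto simp: P_def)
  then obtain E where E: "\<And>p. p \<in> P \<Longrightarrow> E p > 0"
    "\<And>p t r v. p \<in> P \<Longrightarrow> \<bar>t - snd p\<bar> < E p \<Longrightarrow> r > 0 \<Longrightarrow> v \<in> K \<Longrightarrow>
       curve D (fst p) t \<noteq> x + of_real r * v" by metis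
  have nV: "V \<noteq> 0" using V by auto
  \<comment> \<open>The first bound keeps the direction of the pushed-off point inside
    \<open>K\<close>, which excludes the other strands; the second excludes a return to the strand
    itself.\<close>
  define c where "c = min (\<eta> / 2) (\<bar>wedge u V\<bar> / (2 * norm V))"
  have c: "c > 0" "c \<le> \<eta> / 2" "c * norm V < \<bar>wedge u V\<bar>"
  proof -
    show "c > 0" "c \<le> \<eta> / 2" using \<eta>(1) V nV by (auto simp: c_def u_def)
    have "c * norm V \<le> \<bar>wedge u V\<bar> / (2 * norm V) * norm V"
      by (intro mult_right_mono) (auto simp: c_def)
    also have "\<dots> < \<bar>wedge u V\<bar>" using V nV by (simp add: u_def)
    finally show "c * norm V < \<bar>wedge u V\<bar>" .
  qed
  obtain e1 where e1: "e1 > 0" "\<And>s t. \<bar>s - t0\<bar> < e1 \<Longrightarrow> \<bar>t - t0\<bar> < e1 \<Longrightarrow>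
      norm (curve D j s - curve D j t - of_real (s - t) * u) \<le> c * \<bar>s - t\<bar>"
    using strict_derivative[OF j(1) c(1), of t0] unfolding u_def by metis
  define e where "e = Min (insert e1 (E ` P))"
  have e: "e > 0" "e \<le> e1" "\<And>p. p \<in> P \<Longrightarrow> e \<le> E p"
    unfolding e_def using finP E(1) e1(1) by auto
  obtain \<delta> where \<delta>: "\<delta> > 0" "\<And>z. z \<in> support D \<Longrightarrow> dist z x < \<delta> \<Longrightarrow>
      \<exists>j t0 t. (j, t0) \<in> strands D x \<and> \<bar>t - t0\<bar> < e \<and> curve D j t = z"
    using near_strand[OF e(1)] by blast
  \<comment> \<open>Distance from \<open>x\<close> to the pushed-off point per unit of
    \<open>h\<close>: linearisation error, step along the tangent, push along
    \<open>V\<close>.\<close>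
  define M where "M = c + norm u + norm V"
  have M: "M > 0" using c nV by (simp add: M_def add_pos_nonneg)
  show ?thesis
  proof (intro exI[of _ "min e (\<delta> / M)"] conjI allI impI notI)
    fix h \<tau> :: real
    let ?y = "curve D j (t0 + \<sigma> * h)" and ?q = "curve D j (t0 + \<sigma> * h) + of_real (\<tau> * h) * V"
    assume h': "0 < h \<and> h < min e (\<delta> / M) \<and> 0 < \<tau> \<and> \<tau> \<le> 1" and q: "?q \<in> support D"
    then have h: "0 < h" "h < e" "h < e1" "h < \<delta> / M" "0 < \<tau>" "\<tau> \<le> 1" using e by auto
    have \<sigma>h: "\<bar>\<sigma> * h\<bar> = h" using \<sigma> h(1) by (simp add: abs_mult)
    define w where "w = ?y - x - of_real (\<sigma> * h) * u"
    have w: "norm w \<le> c * h"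
      using e1(2)[of "t0 + \<sigma> * h" t0] \<sigma>h h e1(1) j(4) by (simp add: w_def)
    have qx: "?q = x + (w + of_real (\<sigma> * h) * u + of_real (\<tau> * h) * V)" by (simp add: w_def)
    have "dist ?q x \<le> norm w + norm (of_real (\<sigma> * h) * u) + norm (of_real (\<tau> * h) * V)"
      unfolding qx dist_norm by norm
    also have "\<dots> \<le> c * h + h * norm u + h * norm V"
      using w \<sigma>h h by (intro add_mono) (auto simp: norm_mult abs_mult mult_left_le_one_le)
    also have "\<dots> = h * M" by (simp add: M_def algebra_simps)
    also have "\<dots> < \<delta>" using h(4) M by (simp add: field_simps)
    finally obtain j' t0' t where t: "(j', t0') \<in> strands D x" "\<bar>t - t0'\<bar> < e" "curve D j' t = ?q"
      using \<delta>(2)[OF q] by blast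
    show False
    proof (cases "(j', t0') = (j, t0)")
      case True
      \<comment> \<open>If the point lies on the same strand, the chord between two points of the
        strand is a multiple of \<open>V\<close>. Being close to \<open>of_real k * u\<close>, it
        forces k = 0, so that the push would be zero.\<close>
      define k where "k = t - (t0 + \<sigma> * h)"
      define w' where "w' = ?q - ?y - of_real k * u"
      have "norm w' \<le> c * \<bar>k\<bar>"
        using e1(2)[of t "t0 + \<sigma> * h"] t True \<sigma>h h e unfolding w'_def k_def by auto
      then have "norm w' * norm V \<le> c * \<bar>k\<bar> * norm V" by (intro mult_right_mono) auto
      moreover have "wedge w' V = - k * wedge u V"
        by (simp add: w'_def wedge_def algebra_simps)
      then have "\<bar>k\<bar> * \<bar>wedge u V\<bar> \<le> norm w' * norm V"
        using abs_wedge_le[of w' V] by (simp add: abs_mult)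
      ultimately have "\<bar>k\<bar> * \<bar>wedge u V\<bar> \<le> \<bar>k\<bar> * (c * norm V)" by (simp add: mult_ac)
      then have "k = 0" using c(3) by (smt (verit) mult_le_cancel_left_pos)
      then have "?q = ?y" using t(3) True by (simp add: k_def)
      then show False using h nV by simp
    next
      case False
      define v where "v = (of_real \<sigma> * u + of_real \<tau> * V) + w / of_real h"
      have "norm (w / of_real h) \<le> c" using w h(1) by (simp add: norm_divide field_simps)
      then have "v \<in> K" unfolding K_def v_def K0_def using c h by fastforce
      moreover have "?q = x + of_real h * v"
        unfolding qx v_def using h(1) by (simp add: algebra_simps)
      ultimately show False
        using E(2)[of "(j', t0')" t h v] t False h(1) e(3)[of "(j', t0')"] by (auto simp: P_def)
    qed
  qed (use \<delta> M e in auto)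
qed

text \<open>For fixed \<open>h\<close> the push can slide up to \<tau> = 1 without meeting the
  diagram; there the point is seen from \<open>x\<close> in a direction close to \<sigma> u + V, and
  \<open>germ_near\<close> applies. Arbitrarily small \<tau> is allowed so that the result also
  describes the germ at the point of the strand.\<close>

lemma strand_side_germ:
  assumes p: "(j, t0) \<in> strands D x" and \<sigma>: "\<bar>\<sigma>\<bar> = 1"
    and V: "wedge (tangent D (j, t0)) V \<noteq> 0"
    and other: "\<And>p \<tau>. p \<in> strands D x \<Longrightarrow> p \<noteq> (j, t0) \<Longrightarrow> 0 \<le> \<tau> \<Longrightarrow> \<tau> \<le> 1 \<Longrightarrow>
        wedge (tangent D p) (of_real \<sigma> * tangent D (j, t0) + of_real \<tau> * V) \<noteq> 0"
  shows "\<exists>\<delta>>0. \<forall>h \<tau> r. 0 < h \<and> h < \<delta> \<and> 0 < \<tau> \<and> \<tau> \<le> 1 \<and> 0 < r \<and> r < \<delta> \<longrightarrow>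
        connected_component (- support D) (curve D j (t0 + \<sigma> * h) + of_real (\<tau> * h) * V)
          (x + of_real r * (of_real \<sigma> * tangent D (j, t0) + V))"
proof -
  define u where "u = tangent D (j, t0)"
  let ?w = "of_real \<sigma> * u + V"
  note j = strandsD[OF p]
  obtain \<delta>1 where \<delta>1: "\<delta>1 > 0" "\<And>h \<tau>. 0 < h \<Longrightarrow> h < \<delta>1 \<Longrightarrow> 0 < \<tau> \<Longrightarrow> \<tau> \<le> 1 \<Longrightarrow>
        curve D j (t0 + \<sigma> * h) + of_real (\<tau> * h) * V \<notin> support D"
    using strand_push_off[OF p \<sigma> V other] by blast
  have "wedge (tangent D p) ?w \<noteq> 0" if "p \<in> strands D x" for p
    using V other[OF that, of 1] by (cases "p = (j, t0)") (auto simp: u_def wedge_add_right)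
  then obtain \<delta>2 where \<delta>2: "\<delta>2 > 0" "\<And>v r r'. norm (v - ?w) < \<delta>2 \<Longrightarrow> 0 < r \<Longrightarrow> r < \<delta>2 \<Longrightarrow> 0 < r' \<Longrightarrow> r' < \<delta>2 \<Longrightarrow>
    connected_component (- support D) (x + of_real r * v) (x + of_real r' * ?w)"
    using germ_near[of x ?w] by blast
  obtain e1 where e1: "e1 > 0" "\<And>s t. \<bar>s - t0\<bar> < e1 \<Longrightarrow> \<bar>t - t0\<bar> < e1 \<Longrightarrow>
      norm (curve D j s - curve D j t - of_real (s - t) * u) \<le> \<delta>2 / 2 * \<bar>s - t\<bar>"
    using strict_derivative[OF j(1), of "\<delta>2 / 2" t0] \<delta>2(1) unfolding u_def by (metis half_gt_zero)
  show ?thesis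
  proof (intro exI[of _ "min e1 (min \<delta>1 \<delta>2)"] conjI allI impI)
    fix h \<tau> r :: real
    assume "0 < h \<and> h < min e1 (min \<delta>1 \<delta>2) \<and> 0 < \<tau> \<and> \<tau> \<le> 1 \<and> 0 < r \<and> r < min e1 (min \<delta>1 \<delta>2)"
    then have h: "0 < h" "h < e1" "h < \<delta>1" "h < \<delta>2" "0 < \<tau>" "\<tau> \<le> 1" "0 < r" "r < \<delta>2" by auto
    let ?y = "curve D j (t0 + \<sigma> * h)"
    let ?f = "\<lambda>\<tau>. ?y + of_real (\<tau> * h) * V"
    have "connected (?f ` {0<..1})"
      by (intro connected_continuous_image continuous_intros) auto
    moreover have "?f ` {0<..1} \<subseteq> - support D" using \<delta>1(2) h by auto
    moreover have "?f \<tau> \<in> ?f ` {0<..1}" "?f 1 \<in> ?f ` {0<..1}" using h by auto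
    ultimately have 1: "connected_component (- support D) (?f \<tau>) (?f 1)"
      unfolding connected_component_def by blast
    have \<sigma>h: "\<bar>\<sigma> * h\<bar> = h" using \<sigma> h(1) by (simp add: abs_mult)
    define w where "w = ?y - x - of_real (\<sigma> * h) * u"
    have w: "norm w \<le> \<delta>2 / 2 * h"
      using e1(2)[of "t0 + \<sigma> * h" t0] \<sigma>h h e1(1) j(4) by (simp add: w_def)
    define v where "v = ?w + w / of_real h"
    have "norm (v - ?w) \<le> \<delta>2 / 2" unfolding v_def using w h(1) by (simp add: norm_divide field_simps)
    then have "norm (v - ?w) < \<delta>2" using \<delta>2(1) by simp
    moreover have "?f 1 = x + of_real h * v"
      unfolding v_def w_def using h(1) by (simp add: field_simps)
    ultimately have "connected_component (- support D) (?f 1) (x + of_real r * ?w)"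
      using \<delta>2(2)[of v h r] h by simp
    with 1 show "connected_component (- support D) (?f \<tau>)
        (x + of_real r * (of_real \<sigma> * tangent D (j, t0) + V))"
      unfolding u_def by (rule connected_component_trans)
  qed (use e1 \<delta>1 \<delta>2 in auto)
qed

end


section \<open>Winding numbers\<close>

text \<open>The factor \<open>c\<close> rotates the branch cut off the path, so that
  \<open>Ln (c * (w - z))\<close> is a primitive of \<open>1 / (w - z)\<close> along it. The path
  need not be closed.\<close>

lemma winding_number_eq_Ln:
  assumes "valid_path g" and nz: "\<And>w. w \<in> path_image g \<Longrightarrow> c * (w - z) \<notin> \<real>\<^sub>\<le>\<^sub>0"
  shows "winding_number g z = (Ln (c * (pathfinish g - z)) - Ln (c * (pathstart g - z))) / (2 * pi * \<i>)"
proof -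
  have "pathstart g \<in> path_image g" by (rule pathstart_in_path_image)
  then have "c \<noteq> 0" "z \<notin> path_image g" using nz by force+
  have "((\<lambda>w. Ln (c * (w - z))) has_field_derivative 1 / (w - z)) (at w within path_image g)"
    if "w \<in> path_image g" for w
  proof -
    have "w \<noteq> z" using that \<open>z \<notin> _\<close> by auto
    then show ?thesis
      using \<open>c \<noteq> 0\<close> nz[OF that]
      by (auto intro!: derivative_eq_intros simp: divide_simps)
  qed
  then have "((\<lambda>w. 1 / (w - z)) has_contour_integral
      Ln (c * (pathfinish g - z)) - Ln (c * (pathstart g - z))) g"
    using contour_integral_primitive[of "path_image g" "\<lambda>w. Ln (c * (w - z))" "\<lambda>w. 1 / (w - z)" g] assms(1) by auto
  then show ?thesis
    using winding_number_valid_path[OF assms(1) \<open>z \<notin> _\<close>] contour_integral_unique by (auto simp: field_simps)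
qed

text \<open>Seen from \<open>x + r\<i>u\<close> with \<open>r > 0\<close>, no point of the path lies in direction \<open>\<i>u\<close>, so the logarithm
  with its cut in this direction computes the winding number; for \<open>x - r\<i>u\<close> the cut is in direction
  \<open>-\<i>u\<close>. The two logarithms agree ahead of \<open>x\<close> and differ by \<open>2\<pi>\<i>\<close> behind it.\<close>

lemma winding_number_jump:
  assumes g: "valid_path g" and u: "u \<noteq> 0"
    and a: "Re ((pathstart g - x) / u) < 0" and b: "Re ((pathfinish g - x) / u) > 0"
    and x: "\<And>w. w \<in> path_image g \<Longrightarrow> Re ((w - x) / u) = 0 \<Longrightarrow> w = x"
  shows "((\<lambda>r. winding_number g (x + of_real r * (\<i> * u)) - winding_number g (x - of_real r * (\<i> * u)))
     \<longlongrightarrow> 1) (at_right 0)"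
proof -
  define a b where "a = (pathstart g - x) / u" and "b = (pathfinish g - x) / u"
  have ab: "Re a < 0" "Re b > 0" using assms by (auto simp: a_def b_def)
  have left: "winding_number g (x + of_real r * (\<i> * u)) =
      (Ln (\<i> * b + of_real r) - Ln (\<i> * a + of_real r)) / (2 * pi * \<i>)" if "r > 0" for r
  proof -
    have eq: "\<i> / u * (w - (x + of_real r * (\<i> * u))) = \<i> * ((w - x) / u) + of_real r" for w
      using u by (simp add: field_simps)
    \<comment> \<open>In the coordinate z = (w - x) / u the rotated point is
      \<open>\<i> * z + of_real r\<close>. It is real only if Re z = 0, that is for w = x, and then
      it equals r > 0.\<close>
    have "\<i> / u * (w - (x + of_real r * (\<i> * u))) \<notin> \<real>\<^sub>\<le>\<^sub>0" if "w \<in> path_image g" for w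
    proof -
      define z where "z = (w - x) / u"
      have "z = 0" if "Re z = 0" using x[OF \<open>w \<in> _\<close>] that by (simp add: z_def)
      then show ?thesis
        unfolding eq z_def[symmetric] using \<open>r > 0\<close> by (auto simp: complex_nonpos_Reals_iff)
    qed
    from winding_number_eq_Ln[OF g this] show ?thesis
      unfolding eq a_def b_def .
  qed
  have right: "winding_number g (x - of_real r * (\<i> * u)) =
      (Ln (- (\<i> * b) + of_real r) - Ln (- (\<i> * a) + of_real r)) / (2 * pi * \<i>)" if "r > 0" for r
  proof -
    have eq: "- \<i> / u * (w - (x - of_real r * (\<i> * u))) = - (\<i> * ((w - x) / u)) + of_real r" for w
      using u by (simp add: field_simps)
    have "- \<i> / u * (w - (x - of_real r * (\<i> * u))) \<notin> \<real>\<^sub>\<le>\<^sub>0" if "w \<in> path_image g" for w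
    proof -
      define z where "z = (w - x) / u"
      have "z = 0" if "Re z = 0" using x[OF \<open>w \<in> _\<close>] that by (simp add: z_def)
      then show ?thesis
        unfolding eq z_def[symmetric] using \<open>r > 0\<close> by (auto simp: complex_nonpos_Reals_iff)
    qed
    from winding_number_eq_Ln[OF g this] show ?thesis
      unfolding eq a_def b_def .
  qed
  let ?F = "\<lambda>r::real. (Ln (\<i> * b + of_real r) - Ln (\<i> * a + of_real r)) / (2 * pi * \<i>)
     - (Ln (- (\<i> * b) + of_real r) - Ln (- (\<i> * a) + of_real r)) / (2 * pi * \<i>)"
  let ?L = "(Ln (\<i> * b) - Ln (\<i> * a)) / (2 * pi * \<i>) - (Ln (- (\<i> * b)) - Ln (- (\<i> * a))) / (2 * pi * \<i>)"
  have lim: "((\<lambda>r. Ln (w + of_real r)) \<longlongrightarrow> Ln w) (at_right 0)" if "Im w \<noteq> 0" for w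
  proof -
    have "((\<lambda>r. w + of_real r) \<longlongrightarrow> w + of_real 0) (at_right 0)" by (intro tendsto_intros)
    then show ?thesis using that by (intro tendsto_Ln) (auto simp: complex_nonpos_Reals_iff)
  qed
  have "(?F \<longlongrightarrow> ?L) (at_right 0)"
    using ab by (intro tendsto_intros lim) auto
  \<comment> \<open>\<open>\<i> * b\<close> lies in the upper and \<open>\<i> * a\<close> in the
    lower half-plane, so negation shifts their logarithms by \<pi> in opposite directions; together
    the shifts make one full turn.\<close>
  moreover have "Ln (- (\<i> * b)) = Ln (\<i> * b) - \<i> * pi" "Ln (- (\<i> * a)) = Ln (\<i> * a) + \<i> * pi"
  proof -
    have "\<i> * a \<noteq> 0" "\<i> * b \<noteq> 0" using ab by auto
    then show "Ln (- (\<i> * b)) = Ln (\<i> * b) - \<i> * pi" "Ln (- (\<i> * a)) = Ln (\<i> * a) + \<i> * pi"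
      using ab by (simp_all add: Ln_minus)
  qed
  then have "?L = 1" by (simp add: field_simps)
  moreover have "eventually (\<lambda>r. ?F r = winding_number g (x + of_real r * (\<i> * u)) -
      winding_number g (x - of_real r * (\<i> * u))) (at_right 0)"
    using eventually_at_right_less[of 0] by eventually_elim (simp only: left right)
  ultimately show ?thesis using tendsto_cong by force
qed

section \<open>The winding number of the whole diagram and its jump across a strand\<close>

context link_diagram
begin

definition wind :: "complex \<Rightarrow> complex" where
  "wind z = (\<Sum>j<ncomp D. winding_number (curve D j) z)"

text \<open>Off the diagram \<open>wind\<close> is already an integer, and the floor only changes
  its type.\<close>

definition windex :: "complex \<Rightarrow> int" where
  "windex z = \<lfloor>Re (wind z)\<rfloor>"

lemma path_curve: "j < ncomp D \<Longrightarrow> path (curve D j)"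
  by (simp add: path_def continuous_on_curve)

lemma closed_curve: "j < ncomp D \<Longrightarrow> pathfinish (curve D j) = pathstart (curve D j)"
  using curve_add_1[of j 0] by (simp add: pathfinish_def pathstart_def)

lemma path_image_curve: "j < ncomp D \<Longrightarrow> path_image (curve D j) = range (curve D j)"
  by (simp add: path_image_def range_curve)

lemma wind_eq_windex: assumes "z \<notin> support D" shows "wind z = of_int (windex z)"
proof -
  have "wind z \<in> \<int>" unfolding wind_def
  proof (rule Ints_sum)
    fix j assume j: "j \<in> {..<ncomp D}"
    then have "z \<notin> path_image (curve D j)" using assms by (auto simp: path_image_curve support_def)
    then show "winding_number (curve D j) z \<in> \<int>"
      using j by (intro integer_winding_number path_curve closed_curve) auto
  qed
  then show ?thesis unfolding windex_def by (auto elim: Ints_cases)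
qed

lemma windex_connected:
  assumes "connected_component (- support D) a b" shows "windex a = windex b"
proof -
  obtain T where T: "connected T" "T \<subseteq> - support D" "a \<in> T" "b \<in> T"
    using assms unfolding connected_component_def by blast
  have "wind a = wind b" unfolding wind_def
  proof (intro sum.cong refl)
    fix j assume j: "j \<in> {..<ncomp D}"
    then have "T \<inter> path_image (curve D j) = {}" using T(2) by (auto simp: path_image_curve support_def)
    then show "winding_number (curve D j) a = winding_number (curve D j) b"
      using winding_number_eq[OF path_curve closed_curve T(3,4,1)] j by auto
  qed
  then show ?thesis by (simp add: windex_def)
qed

text \<open>Far out all winding numbers vanish; an unbounded region reaches that far, and
  \<open>windex\<close> is constant on it.\<close>

lemma windex_unbounded:
  assumes "\<Delta> \<in> regions D" "\<not> bounded \<Delta>" "z \<in> \<Delta>" shows "windex z = 0"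
proof -
  have "\<exists>B. \<forall>z. B \<le> norm z \<longrightarrow> winding_number (curve D j) z = 0" if "j < ncomp D" for j
    using winding_number_zero_at_infinity[OF path_curve closed_curve] that by blast
  then obtain B where B: "\<And>j z. j < ncomp D \<Longrightarrow> B j \<le> norm z \<Longrightarrow> winding_number (curve D j) z = 0"
    by metis
  define M where "M = Max (insert 0 (B ` {..<ncomp D}))"
  have M: "B j \<le> M" if "j < ncomp D" for j using that by (auto simp: M_def)
  obtain z' where z': "z' \<in> \<Delta>" "norm z' > M" using assms(2) unfolding bounded_iff by (meson not_le)
  then have "wind z' = 0" unfolding wind_def using B M by (intro sum.neutral) (force intro: B)
  moreover have "connected_component (- support D) z z'"
    using assms(1,3) z'(1) unfolding regions_def connected_component_def
    by (meson in_components_connected in_components_subset)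
  ultimately show ?thesis using windex_connected by (simp add: windex_def)
qed

text \<open>Frees the choice of base point, so that a given strand can be put at the middle of the
  parameter interval.\<close>

lemma winding_number_curve_shift:
  assumes "j < ncomp D" "z \<notin> range (curve D j)"
  shows "winding_number (curve D j) z = winding_number (\<lambda>s. curve D j (c + s)) z"
proof -
  have "shiftpath (frac c) (curve D j) s = curve D j (c + s)" for s
  proof -
    have "curve D j (frac c + s) = curve D j (c + s)" 
      using curve_add_int[OF assms(1), of "c + s" "- \<lfloor>c\<rfloor>"] by (simp add: frac_def algebra_simps)
    moreover have "curve D j (frac c + s - 1) = curve D j (frac c + s)"
      using curve_add_1[OF assms(1), of "frac c + s - 1"] by simp
    ultimately show ?thesis by (simp add: shiftpath_def)
  qed
  then have "shiftpath (frac c) (curve D j) = (\<lambda>s. curve D j (c + s))" by auto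
  moreover have "winding_number (shiftpath (frac c) (curve D j)) z = winding_number (curve D j) z"
    using assms path_curve closed_curve
    by (intro winding_number_shiftpath) (auto simp: path_image_curve frac_lt_1 less_imp_le)
  ultimately show ?thesis by simp
qed

lemma eventually_normal_notin_support:
  assumes x: "strands D x = {(j, t0)}"
  defines "u \<equiv> tangent D (j, t0)"
  shows "eventually (\<lambda>r. x + of_real r * (\<i> * u) \<notin> support D \<and> x - of_real r * (\<i> * u) \<notin> support D) (at_right 0)"
proof -
  let ?K = "{\<i> * u, - (\<i> * u)}"
  have "u \<noteq> 0" using x strandsD(1)[of j t0 x] tangent_nz by (simp add: u_def)
  then have "wedge (tangent D p) v \<noteq> 0" if "p \<in> strands D x" "v \<in> ?K" for p v
    using that x by (auto simp: wedge_perp u_def)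
  then obtain \<delta> where \<delta>: "\<delta> > 0" "\<And>v r. v \<in> ?K \<Longrightarrow> 0 < r \<Longrightarrow> r < \<delta> \<Longrightarrow> x + of_real r * v \<notin> support D"
    using support_avoids_cone[of ?K x] by (metis finite.emptyI finite.insertI finite_imp_compact)
  show ?thesis
    using eventually_at_right_real[OF \<delta>(1)]
  proof eventually_elim
    case (elim r)
    then show ?case using \<delta>(2)[of "\<i> * u" r] \<delta>(2)[of "- (\<i> * u)" r] by simp
  qed
qed

text \<open>The curve is cut into a short piece through \<open>x\<close>, which produces the jump,
  and two pieces missing \<open>x\<close>, whose winding numbers are continuous at \<open>x\<close>
  and cancel. The pieces are not closed and their winding numbers not integers, hence a
  limit.\<close>

lemma winding_number_curve_jump:
  assumes x: "strands D x = {(j, t0)}"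
  defines "u \<equiv> tangent D (j, t0)"
  shows "((\<lambda>r. winding_number (curve D j) (x + of_real r * (\<i> * u)) -
      winding_number (curve D j) (x - of_real r * (\<i> * u))) \<longlongrightarrow> 1) (at_right 0)"
proof -
  have p: "(j, t0) \<in> strands D x" using x by auto
  note j = strandsD[OF p]
  have u: "u \<noteq> 0" using tangent_nz[OF j(1)] by (simp add: u_def)
  \<comment> \<open>The base point is half a period before \<open>x\<close>, so \<open>x\<close>
    sits at parameter 1/2 of \<open>G\<close>.\<close>
  define c where "c = t0 - 1 / 2"
  define G where "G = (\<lambda>s. curve D j (c + s))"
  have "G C1_differentiable_on {0..1}"
  proof -
    have "G = curve D j \<circ> (\<lambda>s. c + s)" by (auto simp: G_def)
    moreover have "curve D j C1_differentiable_on (\<lambda>s. c + s) ` {0..1}"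
      using C1_curve[OF j(1)] by (rule C1_differentiable_on_subset) auto
    ultimately show ?thesis
      by (auto intro!: C1_differentiable_compose finite_subset[of "{0..1} \<inter> {s. c + s = y}" "{y - c}" for y] simp: vimage_def)
  qed
  then have vG: "valid_path G" by (simp add: valid_path_def C1_differentiable_imp_piecewise)
  then have pG: "path G" by (rule valid_path_imp_path)
  have "norm u / 2 > 0" using u by simp
  then obtain d0 where d0: "d0 > 0" "\<And>s t. \<bar>s - t0\<bar> < d0 \<Longrightarrow> \<bar>t - t0\<bar> < d0 \<Longrightarrow>
      norm (curve D j s - curve D j t - of_real (s - t) * u) \<le> norm u / 2 * \<bar>s - t\<bar>"
    using strict_derivative[OF j(1), of "norm u / 2" t0] unfolding u_def by blast
  define d where "d = min (d0 / 2) (1 / 4)"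
  have d: "0 < d" "d < d0" "d < 1 / 2" using d0(1) by (auto simp: d_def)
  \<comment> \<open>Measured along \<open>u\<close>, the displacement from \<open>x\<close> differs
    from t - t0 by at most half its size. It therefore has the sign of t - t0 and vanishes only at
    \<open>t0\<close>.\<close>
  have near: "Re ((curve D j t - x) / u) - (t - t0) \<le> \<bar>t - t0\<bar> / 2"
    "(t - t0) - Re ((curve D j t - x) / u) \<le> \<bar>t - t0\<bar> / 2" if "\<bar>t - t0\<bar> \<le> d" for t
  proof -
    have 1: "norm (curve D j t - x - of_real (t - t0) * u) \<le> norm u / 2 * \<bar>t - t0\<bar>"
      using d0(2)[of t t0] that d j(4) by auto
    have "(curve D j t - x - of_real (t - t0) * u) / u = (curve D j t - x) / u - of_real (t - t0)"
      using u by (simp add: field_simps)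
    then have "norm ((curve D j t - x) / u - of_real (t - t0)) = norm (curve D j t - x - of_real (t - t0) * u) / norm u"
      by (metis norm_divide)
    also have "\<dots> \<le> \<bar>t - t0\<bar> / 2" using 1 u by (simp add: field_simps)
    finally have 2: "norm ((curve D j t - x) / u - of_real (t - t0)) \<le> \<bar>t - t0\<bar> / 2" .
    have "\<bar>Re ((curve D j t - x) / u) - (t - t0)\<bar> \<le> \<bar>t - t0\<bar> / 2"
      using order_trans[OF abs_Re_le_cmod 2] by (simp only: minus_complex.sel Re_complex_of_real)
    then show "Re ((curve D j t - x) / u) - (t - t0) \<le> \<bar>t - t0\<bar> / 2"
      "(t - t0) - Re ((curve D j t - x) / u) \<le> \<bar>t - t0\<bar> / 2"
      by linarith+
  qed
  \<comment> \<open>Only one strand passes through \<open>x\<close>, so a return to \<open>x\<close>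
    shifts the parameter by an integer; no nonzero integer is that small.\<close>
  have far: "curve D j t \<noteq> x" if "d \<le> \<bar>t - t0\<bar>" "\<bar>t - t0\<bar> \<le> 1 / 2" for t
  proof
    assume "curve D j t = x"
    then have "frac t = t0" using strandsI[OF j(1), of t] x by auto
    then have "t - t0 = of_int \<lfloor>t\<rfloor>" by (simp add: frac_def)
    then obtain k :: int where k: "t - t0 = of_int k" by blast
    have "d \<le> of_int \<bar>k\<bar>" "of_int \<bar>k\<bar> \<le> (1 / 2 :: real)" using that unfolding k by simp_all
    then have "\<bar>k\<bar> > 0" "\<bar>k\<bar> < 1" using d(1) by linarith+
    then show False by linarith
  qed
  let ?N = "subpath (1 / 2 - d) (1 / 2 + d) G"
  let ?F = "subpath 0 (1 / 2 - d) G" and ?F' = "subpath (1 / 2 + d) 1 G"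
  let ?p = "\<lambda>r::real. x + of_real r * (\<i> * u)" and ?m = "\<lambda>r::real. x - of_real r * (\<i> * u)"
  have near_lim: "((\<lambda>r. winding_number ?N (?p r) - winding_number ?N (?m r)) \<longlongrightarrow> 1) (at_right 0)"
  proof (rule winding_number_jump[OF _ u])
    show "valid_path ?N" using vG d by (intro valid_path_subpath) auto
    show "Re ((pathstart ?N - x) / u) < 0" "Re ((pathfinish ?N - x) / u) > 0"
      using near[of "t0 - d"] near[of "t0 + d"] d by (auto simp: G_def c_def)
    fix w assume "w \<in> path_image ?N" and 0: "Re ((w - x) / u) = 0"
    then obtain s where s: "s \<in> {1 / 2 - d..1 / 2 + d}" "w = G s"
      using d by (auto simp: path_image_subpath)
    then have "w = curve D j (c + s)" "\<bar>c + s - t0\<bar> \<le> d" by (auto simp: G_def c_def abs_le_iff)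
    then have "c + s = t0" using near[of "c + s"] 0 by auto
    then show "w = x" using j(4) s(2) by (simp add: G_def)
  qed
  have cont: "((\<lambda>r. winding_number F (?p r)) \<longlongrightarrow> winding_number F x) (at_right 0)"
    "((\<lambda>r. winding_number F (?m r)) \<longlongrightarrow> winding_number F x) (at_right 0)"
    if "path F" "x \<notin> path_image F" for F
  proof -
    have "(?p \<longlongrightarrow> x + of_real 0 * (\<i> * u)) (at_right 0)" "(?m \<longlongrightarrow> x - of_real 0 * (\<i> * u)) (at_right 0)"
      by (intro tendsto_intros)+
    then show "((\<lambda>r. winding_number F (?p r)) \<longlongrightarrow> winding_number F x) (at_right 0)"
      "((\<lambda>r. winding_number F (?m r)) \<longlongrightarrow> winding_number F x) (at_right 0)"
      using continuous_at_winding_number[OF that] by (auto intro: isCont_tendsto_compose)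
  qed
  have F: "path ?F" "path ?F'" using pG d by (auto intro!: path_subpath)
  have xF: "x \<notin> path_image ?F" "x \<notin> path_image ?F'"
  proof -
    have "x \<noteq> G s" if "s \<in> {0..1 / 2 - d} \<union> {1 / 2 + d..1}" for s
      using far[of "c + s"] that d unfolding G_def c_def by (auto simp: abs_if)
    then have "x \<notin> G ` {0..1 / 2 - d}" "x \<notin> G ` {1 / 2 + d..1}" by blast+
    then show "x \<notin> path_image ?F" "x \<notin> path_image ?F'" using d by (simp_all add: path_image_subpath)
  qed
  have "((\<lambda>r. (winding_number ?F (?p r) - winding_number ?F (?m r))
      + (winding_number ?N (?p r) - winding_number ?N (?m r))
      + (winding_number ?F' (?p r) - winding_number ?F' (?m r))) \<longlongrightarrow>
      (winding_number ?F x - winding_number ?F x) + 1 + (winding_number ?F' x - winding_number ?F' x)) (at_right 0)"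
    by (intro tendsto_add tendsto_diff cont F xF near_lim)
  then have lim: "((\<lambda>r. (winding_number ?F (?p r) - winding_number ?F (?m r))
      + (winding_number ?N (?p r) - winding_number ?N (?m r))
      + (winding_number ?F' (?p r) - winding_number ?F' (?m r))) \<longlongrightarrow> 1) (at_right 0)" by simp
  have split: "winding_number (curve D j) z =
      winding_number ?F z + winding_number ?N z + winding_number ?F' z" if "z \<notin> support D" for z
  proof -
    have z: "z \<notin> range (curve D j)" using that j(1) by (auto simp: support_def)
    then have zG: "z \<notin> path_image G" by (auto simp: path_image_def G_def)
    have "winding_number ?F z + winding_number ?N z = winding_number (subpath 0 (1 / 2 + d) G) z"
      "winding_number (subpath 0 (1 / 2 + d) G) z + winding_number ?F' z = winding_number (subpath 0 1 G) z"
      by (rule winding_number_subpath_combine[OF pG zG]; use d in simp)+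
    then show ?thesis using winding_number_curve_shift[OF j(1) z, of c] by (simp add: G_def)
  qed
  have "eventually (\<lambda>r. ?p r \<notin> support D \<and> ?m r \<notin> support D) (at_right 0)"
    using eventually_normal_notin_support[OF x] by (simp add: u_def)
  then have "eventually (\<lambda>r. (winding_number ?F (?p r) - winding_number ?F (?m r))
      + (winding_number ?N (?p r) - winding_number ?N (?m r))
      + (winding_number ?F' (?p r) - winding_number ?F' (?m r)) =
      winding_number (curve D j) (?p r) - winding_number (curve D j) (?m r)) (at_right 0)"
  proof eventually_elim
    case (elim r)
    then have "?p r \<notin> support D" "?m r \<notin> support D" by auto
    then show ?case using split by (simp add: algebra_simps)
  qed
  with lim show ?thesis by (rule Lim_transform_eventually)
qed

text \<open>Only the component through \<open>x\<close> has a winding number that jumps there. The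
  total difference tends to 1 and is an integer off the diagram, so it is eventually equal to
  1.\<close>

lemma windex_jump:
  assumes x: "strands D x = {(j, t0)}"
  defines "u \<equiv> tangent D (j, t0)"
  shows "eventually (\<lambda>r. windex (x + of_real r * (\<i> * u)) = windex (x - of_real r * (\<i> * u)) + 1) (at_right 0)"
proof -
  let ?p = "\<lambda>r::real. x + of_real r * (\<i> * u)" and ?m = "\<lambda>r::real. x - of_real r * (\<i> * u)"
  have p: "(j, t0) \<in> strands D x" using x by auto
  note j = strandsD[OF p]
  have u: "u \<noteq> 0" using tangent_nz[OF j(1)] by (simp add: u_def)
  have "((\<lambda>r. winding_number (curve D k) (?p r) - winding_number (curve D k) (?m r)) \<longlongrightarrow>
      (if k = j then 1 else 0)) (at_right 0)" if k: "k < ncomp D" for k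
  proof (cases "k = j")
    case False
    have "x \<notin> range (curve D k)" using strandsI[OF k] x False by auto
    then have c: "isCont (winding_number (curve D k)) x"
      using k by (intro continuous_at_winding_number path_curve) (auto simp: path_image_curve)
    have lim: "(?p \<longlongrightarrow> x + of_real 0 * (\<i> * u)) (at_right 0)" "(?m \<longlongrightarrow> x - of_real 0 * (\<i> * u)) (at_right 0)"
      by (intro tendsto_intros)+
    have "((\<lambda>r. winding_number (curve D k) (?p r) - winding_number (curve D k) (?m r)) \<longlongrightarrow>
      winding_number (curve D k) x - winding_number (curve D k) x) (at_right 0)"
      using lim by (intro tendsto_diff isCont_tendsto_compose[OF c]) simp_all
    then show ?thesis using False by simp
  qed (use winding_number_curve_jump[OF x] u_def in simp)
  then have "((\<lambda>r. \<Sum>k<ncomp D. winding_number (curve D k) (?p r) - winding_number (curve D k) (?m r)) \<longlongrightarrow>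
      (\<Sum>k<ncomp D. if k = j then 1 else 0)) (at_right 0)"
    by (intro tendsto_sum) auto
  then have "((\<lambda>r. wind (?p r) - wind (?m r)) \<longlongrightarrow> 1) (at_right 0)"
    using j(1) by (simp add: wind_def sum_subtractf)
  then have "eventually (\<lambda>r. dist (wind (?p r) - wind (?m r)) 1 < 1) (at_right 0)"
    by (rule tendstoD) auto
  moreover have "eventually (\<lambda>r. ?p r \<notin> support D \<and> ?m r \<notin> support D) (at_right 0)"
    using eventually_normal_notin_support[OF x] by (simp add: u_def)
  ultimately show ?thesis
  proof eventually_elim
    case (elim r)
    then have "?p r \<notin> support D" "?m r \<notin> support D" by auto
    then have "norm (of_int (windex (?p r) - windex (?m r) - 1) :: complex) < 1"
      using elim(1) by (simp add: wind_eq_windex dist_norm)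
    then have "\<bar>windex (?p r) - windex (?m r) - 1\<bar> < 1"
      by (metis norm_of_int of_int_abs of_int_less_1_iff)
    then show ?case by simp
  qed
qed

text \<open>The value of \<^const>\<open>windex\<close> just off \<open>x\<close> in direction \<open>v\<close>; meaningful if \<open>v\<close> is transverse to all
  strands at \<open>x\<close>.\<close>

definition germ_index :: "complex \<Rightarrow> complex \<Rightarrow> int" where
  "germ_index x v = (THE n. eventually (\<lambda>r. windex (x + of_real r * v) = n) (at_right 0))"

lemma germ_index_eqI:
  assumes "eventually (\<lambda>r. windex (x + of_real r * v) = n) (at_right 0)"
  shows "germ_index x v = n"
  unfolding germ_index_def
proof (rule the_equality, rule assms)
  fix m assume "eventually (\<lambda>r. windex (x + of_real r * v) = m) (at_right 0)"
  with assms have "eventually (\<lambda>r::real. m = n) (at_right 0)" by eventually_elim simp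
  then show "m = n" by (simp add: eventually_const)
qed

lemma germ_index_ball:
  assumes nz: "\<And>p. p \<in> strands D x \<Longrightarrow> wedge (tangent D p) w \<noteq> 0"
  shows "\<exists>\<delta>>0. \<forall>v r. norm (v - w) < \<delta> \<and> 0 < r \<and> r < \<delta> \<longrightarrow>
    x + of_real r * v \<notin> support D \<and> windex (x + of_real r * v) = germ_index x w"
proof -
  obtain \<delta> where \<delta>: "\<delta> > 0" "\<And>v r r'. norm (v - w) < \<delta> \<Longrightarrow> 0 < r \<Longrightarrow> r < \<delta> \<Longrightarrow> 0 < r' \<Longrightarrow> r' < \<delta> \<Longrightarrow>
    connected_component (- support D) (x + of_real r * v) (x + of_real r' * w)"
    using germ_near[OF nz] by blast
  define n where "n = windex (x + of_real (\<delta> / 2) * w)"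
  have n: "windex (x + of_real r * v) = n" if "norm (v - w) < \<delta>" "0 < r" "r < \<delta>" for v r
    unfolding n_def using \<delta>(1) that by (intro windex_connected \<delta>(2)) auto
  have "eventually (\<lambda>r. r \<in> {0<..<\<delta>}) (at_right 0)"
    using \<delta>(1) by (rule eventually_at_right_real)
  then have "germ_index x w = n"
    by (intro germ_index_eqI, eventually_elim) (use n \<delta>(1) in auto)
  moreover have "x + of_real r * v \<notin> support D" if "norm (v - w) < \<delta>" "0 < r" "r < \<delta>" for v r
    using connected_component_in[OF \<delta>(2)[of v r r]] that by auto
  ultimately show ?thesis using n \<delta>(1) by blast
qed

lemma eventually_germ_index:
  assumes nz: "\<And>p. p \<in> strands D x \<Longrightarrow> wedge (tangent D p) w \<noteq> 0"
  shows "eventually (\<lambda>r. windex (x + of_real r * w) = germ_index x w) (at_right 0)"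
proof -
  obtain \<delta> where \<delta>: "\<delta> > 0" "\<And>r. 0 < r \<Longrightarrow> r < \<delta> \<Longrightarrow> windex (x + of_real r * w) = germ_index x w"
  proof -
    obtain \<delta> where "\<delta> > 0" "\<forall>v r. norm (v - w) < \<delta> \<and> 0 < r \<and> r < \<delta> \<longrightarrow>
        x + of_real r * v \<notin> support D \<and> windex (x + of_real r * v) = germ_index x w"
      using germ_index_ball[OF nz] by blast
    then show ?thesis using that[of \<delta>] by simp
  qed
  show ?thesis
    using eventually_at_right_real[OF \<delta>(1)] by eventually_elim (use \<delta>(2) in auto)
qed

text \<open>Fixing the sign of the wedge with every tangent cuts out a convex sector, so all
  directions on the segment from \<open>v\<close> to \<open>w\<close> are transverse.\<close>

lemma same_sign_connected:
  assumes same: "\<And>p. p \<in> strands D x \<Longrightarrow> wedge (tangent D p) v * wedge (tangent D p) w > 0"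
  shows "\<exists>\<delta>>0. \<forall>r r'. 0 < r \<and> r < \<delta> \<and> 0 < r' \<and> r' < \<delta> \<longrightarrow>
    connected_component (- support D) (x + of_real r * v) (x + of_real r' * w)"
proof -
  have "wedge (tangent D p) q \<noteq> 0" if p: "p \<in> strands D x" and q: "q \<in> closed_segment v w" for p q
  proof -
    obtain a where a: "0 \<le> a" "a \<le> 1" "q = of_real (1 - a) * v + of_real a * w"
      using q by (auto simp: closed_segment_def scaleR_conv_of_real)
    have "wedge (tangent D p) q = (1 - a) * wedge (tangent D p) v + a * wedge (tangent D p) w"
      unfolding a(3) wedge_add_right wedge_simps ..
    moreover have "(wedge (tangent D p) v > 0 \<and> wedge (tangent D p) w > 0) \<or>
        (wedge (tangent D p) v < 0 \<and> wedge (tangent D p) w < 0)"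
      using same[OF p] by (auto simp: zero_less_mult_iff)
    ultimately show ?thesis using a(1,2)
      by (smt (verit) mult_nonneg_nonneg mult_pos_pos mult_nonneg_nonpos mult_pos_neg)
  qed
  then obtain \<delta> where "\<delta> > 0" "\<forall>v'\<in>closed_segment v w. \<forall>w'\<in>closed_segment v w. \<forall>r r'. 0 < r \<and> r < \<delta> \<and> 0 < r' \<and> r' < \<delta> \<longrightarrow>
      connected_component (- support D) (x + of_real r * v') (x + of_real r' * w')"
    using germ_connected[of "closed_segment v w" x] by auto
  then show ?thesis by (meson ends_in_segment)
qed

lemma germ_index_cong:
  assumes same: "\<And>p. p \<in> strands D x \<Longrightarrow> wedge (tangent D p) v * wedge (tangent D p) w > 0"
  shows "germ_index x v = germ_index x w"
proof -
  obtain \<delta> where \<delta>: "\<delta> > 0" "\<And>r r'. 0 < r \<Longrightarrow> r < \<delta> \<Longrightarrow> 0 < r' \<Longrightarrow> r' < \<delta> \<Longrightarrow>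
    connected_component (- support D) (x + of_real r * v) (x + of_real r' * w)"
    using same_sign_connected[OF same] by blast
  have "eventually (\<lambda>r. windex (x + of_real r * w) = germ_index x w) (at_right 0)"
    by (rule eventually_germ_index) (use same in fastforce)
  moreover have "eventually (\<lambda>r. r \<in> {0<..<\<delta>}) (at_right 0)"
    using \<delta>(1) by (rule eventually_at_right_real)
  ultimately have "eventually (\<lambda>r. windex (x + of_real r * v) = germ_index x w) (at_right 0)"
    by eventually_elim (use windex_connected[OF \<delta>(2)] in auto)
  then show ?thesis by (rule germ_index_eqI)
qed

lemma germ_index_jump:
  assumes x: "strands D x = {p}" and v: "wedge (tangent D p) v > 0" and w: "wedge (tangent D p) w < 0"
  shows "germ_index x v = germ_index x w + 1"
proof -
  obtain j t0 where p: "p = (j, t0)" by force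
  let ?u = "tangent D p"
  have u: "?u \<noteq> 0" using v by auto
  have eq: "germ_index x v = germ_index x (\<i> * ?u)" "germ_index x w = germ_index x (- (\<i> * ?u))"
    using x v w u by (auto intro!: germ_index_cong mult_neg_pos simp: wedge_perp)
  have "eventually (\<lambda>r. windex (x + of_real r * (\<i> * ?u)) = germ_index x (\<i> * ?u)) (at_right 0)"
    "eventually (\<lambda>r. windex (x + of_real r * (- (\<i> * ?u))) = germ_index x (- (\<i> * ?u))) (at_right 0)"
    by (rule eventually_germ_index; use x u in \<open>simp add: wedge_perp\<close>)+
  moreover have "eventually (\<lambda>r. windex (x + of_real r * (\<i> * ?u)) = windex (x - of_real r * (\<i> * ?u)) + 1) (at_right 0)"
    using windex_jump[of x j t0] x p by simp
  ultimately have "eventually (\<lambda>r::real. germ_index x (\<i> * ?u) = germ_index x (- (\<i> * ?u)) + 1) (at_right 0)"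
    by eventually_elim simp
  then have "germ_index x (\<i> * ?u) = germ_index x (- (\<i> * ?u)) + 1" by (simp add: eventually_const)
  with eq show ?thesis by simp
qed

end


section \<open>Counting jumps along a path\<close>

text \<open>Adding to \<open>f\<close> the jumps already passed gives a function that is locally
  constant even at the points of \<open>H\<close>, hence constant on the interval.\<close>

lemma sum_of_jumps:
  fixes f :: "real \<Rightarrow> 'b::ab_group_add"
  assumes ab: "a \<le> b" and H: "finite H" "H \<subseteq> {a<..<b}"
    and const: "\<And>s. s \<in> {a..b} - H \<Longrightarrow> eventually (\<lambda>s'. f s' = f s) (at s within {a..b})"
    and left: "\<And>h. h \<in> H \<Longrightarrow> eventually (\<lambda>s. f s = L h) (at_left h)"
    and right: "\<And>h. h \<in> H \<Longrightarrow> eventually (\<lambda>s. f s = R h) (at_right h)"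
  shows "f a - f b = (\<Sum>h\<in>H. L h - R h)"
proof -
  \<comment> \<open>At a jump \<open>F\<close> takes the left value and the sum still leaves this
    jump out; just after it the value is R s + (L s - R s) = L s, so \<open>F\<close> does not
    change.\<close>
  define F where "F s = (if s \<in> H then L s else f s) + (\<Sum>h\<in>{h \<in> H. h < s}. L h - R h)" for s
  have "eventually (\<lambda>s'. F s = F s') (at s within {a..b})" if s: "s \<in> {a..b}" for s
  proof -
    have "eventually (\<lambda>s'. \<forall>h\<in>H - {s}. (h < s' \<longleftrightarrow> h < s) \<and> s' \<noteq> h) (at s)"
    proof (intro eventually_ball_finite ballI)
      fix h assume "h \<in> H - {s}"
      then consider "h < s" | "s < h" by fastforce
      then show "eventually (\<lambda>s'. (h < s' \<longleftrightarrow> h < s) \<and> s' \<noteq> h) (at s)"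
      proof cases
        case 1
        have "eventually (\<lambda>s'. s' > h) (at s)" by (rule order_tendstoD(1)[OF tendsto_ident_at 1])
        then show ?thesis by eventually_elim (use 1 in auto)
      next
        case 2
        have "eventually (\<lambda>s'. s' < h) (at s)" by (rule order_tendstoD(2)[OF tendsto_ident_at 2])
        then show ?thesis by eventually_elim (use 2 in auto)
      qed
    qed (use H in auto)
    then have ev: "eventually (\<lambda>s'. s' \<notin> H \<and> {h \<in> H. h < s'} = {h \<in> H. h < s} \<union> {h \<in> H. h = s \<and> s < s'}) (at s)"
      using eventually_neq_at_within[of s s UNIV]
    proof eventually_elim
      case (elim s')
      then have "h < s' \<longleftrightarrow> h < s \<or> (h = s \<and> s < s')" if "h \<in> H" for h
        using that by (cases "h = s") auto
      moreover have "s' \<notin> H" using elim by blast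
      ultimately show ?case by blast
    qed
    show ?thesis
    proof (cases "s \<in> H")
      case False
      have "eventually (\<lambda>s'. s' \<notin> H \<and> {h \<in> H. h < s'} = {h \<in> H. h < s} \<union> {h \<in> H. h = s \<and> s < s'}) (at s within {a..b})"
        using ev by (rule filter_leD[OF at_le, rotated]) auto
      moreover have "eventually (\<lambda>s'. f s' = f s) (at s within {a..b})"
        using const s False by auto
      ultimately show ?thesis
      proof eventually_elim
        case (elim s')
        then have "{h \<in> H. h < s'} = {h \<in> H. h < s}" using False by blast
        with elim False show ?case by (simp add: F_def)
      qed
    next
      case True
      have "eventually (\<lambda>s'. s' < s) (at_left s)" "eventually (\<lambda>s'. s' > s) (at_right s)"
        by (simp_all add: eventually_at_filter)
      moreover note ev[unfolded eventually_at_split] left[OF True] right[OF True]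
      ultimately have l: "eventually (\<lambda>s'. s' < s \<and> s' \<notin> H \<and> f s' = L s \<and>
            {h \<in> H. h < s'} = {h \<in> H. h < s} \<union> {h \<in> H. h = s \<and> s < s'}) (at_left s)"
        and r: "eventually (\<lambda>s'. s' > s \<and> s' \<notin> H \<and> f s' = R s \<and>
            {h \<in> H. h < s'} = {h \<in> H. h < s} \<union> {h \<in> H. h = s \<and> s < s'}) (at_right s)"
        by (simp_all add: eventually_conj_iff)
      from l have l: "eventually (\<lambda>s'. F s = F s') (at_left s)"
      proof eventually_elim
        case (elim s')
        then have "{h \<in> H. h < s'} = {h \<in> H. h < s}" by auto
        with elim True show ?case by (simp add: F_def)
      qed
      from r have r: "eventually (\<lambda>s'. F s = F s') (at_right s)"
      proof eventually_elim
        case (elim s')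
        then have eq: "{h \<in> H. h < s'} = insert s {h \<in> H. h < s}" using True by auto
        have "s' \<notin> H" "f s' = R s" using elim by auto
        then show ?case unfolding F_def eq using True H(1) by simp
      qed
      have "eventually (\<lambda>s'. F s = F s') (at s)" using l r by (simp add: eventually_at_split)
      then show ?thesis by (rule filter_leD[OF at_le, rotated]) auto
    qed
  qed
  then have "F a = F b"
    using ab by (intro connected_local_const[of "{a..b}"]) auto
  moreover have "{h \<in> H. h < a} = {}" "{h \<in> H. h < b} = H" "a \<notin> H" "b \<notin> H" using H(2) by auto
  ultimately show ?thesis by (simp add: F_def algebra_simps)
qed

text \<open>Sard's theorem in dimension one. Functions on the line are rewritten on
  \<open>real^1\<close>, where \<open>baby_Sard\<close> applies: at a critical point the derivative
  matrix is 0, of rank below 1.\<close>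

lemma negligible_critical_values:
  fixes f :: "real \<Rightarrow> real"
  assumes "\<And>t. (f has_real_derivative f' t) (at t)"
  shows "negligible ((\<lambda>x::real^1. f (vec_nth x 1) *\<^sub>R (1::real^1)) ` {x. f' (vec_nth x 1) = 0})"
proof (rule baby_Sard)
  fix x :: "real^1" assume "x \<in> {x. f' (vec_nth x 1) = 0}"
  then have "(f has_derivative (\<lambda>h. 0)) (at (vec_nth x 1))"
    using assms[of "vec_nth x 1"] by (simp add: has_field_derivative_def lambda_zero)
  then have "((\<lambda>x::real^1. f (vec_nth x 1)) has_derivative (\<lambda>h. 0)) (at x)"
    by (intro has_derivative_compose[of "\<lambda>x. vec_nth x 1" "\<lambda>h. vec_nth h 1" x UNIV f "\<lambda>h. 0"])
       (auto intro!: bounded_linear_imp_has_derivative bounded_linear_vec_nth)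
  then have "((\<lambda>x::real^1. f (vec_nth x 1) *\<^sub>R (1::real^1)) has_derivative (\<lambda>h. 0 *\<^sub>R 1)) (at x)"
    by (rule has_derivative_scaleR_left)
  then show "((\<lambda>x::real^1. f (vec_nth x 1) *\<^sub>R (1::real^1)) has_derivative (\<lambda>h. 0)) (at x within {x. f' (vec_nth x 1) = 0})"
    by (simp add: has_derivative_at_withinI)
  have "matrix (\<lambda>h::real^1. 0::real^1) = 0" by (simp add: matrix_def vec_eq_iff)
  then show "rank (matrix (\<lambda>h::real^1. 0::real^1)) < CARD(1)"
    by (simp add: rank_dim_range)
qed simp

text \<open>The critical values of finitely many functions, together with the finite set
  \<open>F\<close>, are negligible and cannot fill an open interval.\<close>

lemma exists_regular_value:
  fixes f f' :: "nat \<Rightarrow> real \<Rightarrow> real"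
  assumes der: "\<And>j t. j < n \<Longrightarrow> (f j has_real_derivative f' j t) (at t)"
    and F: "finite F" and ab: "a < b"
  shows "\<exists>c. a < c \<and> c < b \<and> c \<notin> F \<and> (\<forall>j<n. \<forall>t. f j t = c \<longrightarrow> f' j t \<noteq> 0)"
proof -
  define B where "B = (\<Union>j<n. (\<lambda>x::real^1. f j (vec_nth x 1) *\<^sub>R (1::real^1)) ` {x. f' j (vec_nth x 1) = 0}) \<union>
    (\<lambda>c. c *\<^sub>R (1::real^1)) ` F"
  have "negligible ((\<lambda>x::real^1. f j (vec_nth x 1) *\<^sub>R (1::real^1)) ` {x. f' j (vec_nth x 1) = 0})"
    if "j < n" for j using negligible_critical_values[OF der[OF that]] .
  then have "negligible (\<Union>j<n. (\<lambda>x::real^1. f j (vec_nth x 1) *\<^sub>R (1::real^1)) ` {x. f' j (vec_nth x 1) = 0})"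
    by (intro negligible_Union) auto
  then have "negligible B" unfolding B_def
    using F by (intro negligible_Un) auto
  moreover have "open {x::real^1. a < vec_nth x 1 \<and> vec_nth x 1 < b}"
    by (intro open_Collect_conj open_Collect_less continuous_intros)
  moreover have "((a + b) / 2) *\<^sub>R (1::real^1) \<in> {x::real^1. a < vec_nth x 1 \<and> vec_nth x 1 < b}" using ab by simp
  ultimately have "\<not> {x::real^1. a < vec_nth x 1 \<and> vec_nth x 1 < b} \<subseteq> B"
    using open_not_negligible negligible_subset by blast
  then obtain x :: "real^1" where x: "a < vec_nth x 1" "vec_nth x 1 < b" "x \<notin> B" by auto
  have B: "c *\<^sub>R (1::real^1) \<noteq> x" if "c *\<^sub>R (1::real^1) \<in> B" for c using x(3) that by auto
  have xx: "(vec_nth x 1) *\<^sub>R (1::real^1) = x" by (simp add: vec_eq_iff forall_1)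
  have "f' j t \<noteq> 0" if "j < n" "f j t = vec_nth x 1" for j t
  proof
    assume "f' j t = 0"
    then have "t *\<^sub>R (1::real^1) \<in> {x. f' j (vec_nth x 1) = 0}" by simp
    then have "f j (vec_nth (t *\<^sub>R (1::real^1)) 1) *\<^sub>R (1::real^1) \<in> B" unfolding B_def using that(1) by blast
    then show False using x(3) that(2) xx by simp
  qed
  moreover have "vec_nth x 1 \<notin> F" using x(3) xx unfolding B_def by force
  ultimately show ?thesis using x by blast
qed

section \<open>The index of a region as a winding number\<close>

context link_diagram
begin

lemma strands_simple:
  assumes "x \<in> support D" "x \<notin> crossings D" shows "\<exists>p. strands D x = {p}"
proof -
  have "card (strands D x) \<noteq> 2" "card (strands D x) \<le> 2" "card (strands D x) \<noteq> 0"
    using assms card_strands_le finite_strands by (auto simp: crossings_def support_iff)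
  then have "card (strands D x) = 1" by linarith
  then show ?thesis by (rule card_1_singletonE) blast
qed

lemma strands_crossing:
  assumes "x \<in> crossings D" shows "strands D x = {over D x, under D x}" "under D x \<noteq> over D x"
proof -
  obtain p q where pq: "strands D x = {p, q}" "p \<noteq> q"
    using assms by (auto simp: crossings_def card_2_iff)
  have o: "over D x = p \<or> over D x = q" using over_in_strands[OF assms] pq by auto
  then have "under D x = (if over D x = p then q else p)"
    unfolding under_def pq(1) using pq(2) by (intro the_equality) auto
  then show "strands D x = {over D x, under D x}" "under D x \<noteq> over D x" using pq o by auto
qed

text \<open>Difference quotients tend to \<open>v\<close>, so just after \<open>h\<close> the path
  lies on rays from \<open>p h\<close> in directions close to \<open>v\<close>. Before
  \<open>h\<close> the positive radius is h - s, which reverses the direction.\<close>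

lemma path_germ:
  assumes p: "(p has_vector_derivative v) (at h)"
    and nz: "\<And>q. q \<in> strands D (p h) \<Longrightarrow> wedge (tangent D q) v \<noteq> 0"
  shows "eventually (\<lambda>s. windex (p s) = germ_index (p h) v) (at_right h)"
    and "eventually (\<lambda>s. windex (p s) = germ_index (p h) (- v)) (at_left h)"
proof -
  have "\<And>q. q \<in> strands D (p h) \<Longrightarrow> wedge (tangent D q) (- v) \<noteq> 0" using nz by simp
  then obtain \<delta>1 where \<delta>1: "\<delta>1 > 0"
    "\<forall>w r. norm (w - (- v)) < \<delta>1 \<and> 0 < r \<and> r < \<delta>1 \<longrightarrow> p h + of_real r * w \<notin> support D \<and>
      windex (p h + of_real r * w) = germ_index (p h) (- v)" using germ_index_ball by blast
  obtain \<delta>2 where \<delta>2: "\<delta>2 > 0"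
    "\<forall>w r. norm (w - v) < \<delta>2 \<and> 0 < r \<and> r < \<delta>2 \<longrightarrow> p h + of_real r * w \<notin> support D \<and>
      windex (p h + of_real r * w) = germ_index (p h) v" using germ_index_ball[of "p h" v] nz by blast
  define \<delta> where "\<delta> = min \<delta>1 \<delta>2"
  have \<delta>: "\<delta> > 0" "\<delta> / 2 < \<delta>1" "\<delta> / 2 < \<delta>2" "\<delta> \<le> \<delta>1" "\<delta> \<le> \<delta>2" using \<delta>1(1) \<delta>2(1) by (auto simp: \<delta>_def)
  obtain d where d: "d > 0" "\<And>s. \<bar>s - h\<bar> < d \<Longrightarrow> norm (p s - p h - of_real (s - h) * v) \<le> \<delta> / 2 * \<bar>s - h\<bar>"
    using p \<delta>(1) unfolding has_vector_derivative_def has_derivative_at_alt scaleR_conv_of_real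
    by (metis half_gt_zero real_norm_def)
  have quot: "norm ((p s - p h) / of_real (s - h) - v) \<le> \<delta> / 2" if "\<bar>s - h\<bar> < d" "s \<noteq> h" for s
  proof -
    have "(p s - p h) / of_real (s - h) - v = (p s - p h - of_real (s - h) * v) / of_real (s - h)"
      using that(2) by (simp add: field_simps)
    also have "norm \<dots> = norm (p s - p h - of_real (s - h) * v) / \<bar>s - h\<bar>"
      by (simp only: norm_divide norm_of_real)
    also have "\<dots> \<le> \<delta> / 2" using d(2)[OF that(1)] that(2) by (simp add: divide_le_eq)
    finally show ?thesis .
  qed
  have "eventually (\<lambda>s. s \<in> {h<..<h + min d \<delta>}) (at_right h)"
    using d(1) \<delta>(1) by (intro eventually_at_right_real) auto
  then show "eventually (\<lambda>s. windex (p s) = germ_index (p h) v) (at_right h)"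
  proof eventually_elim
    case (elim s)
    define w where "w = (p s - p h) / of_real (s - h)"
    have "p s = p h + of_real (s - h) * w" using elim by (simp add: w_def)
    moreover have "norm (w - v) \<le> \<delta> / 2" unfolding w_def using elim by (intro quot) auto
    then have "norm (w - v) < \<delta>2" using \<delta> by linarith
    moreover have "0 < s - h \<and> s - h < \<delta>2" using elim \<delta> by auto
    ultimately show ?case using \<delta>2(2) by metis
  qed
  have "eventually (\<lambda>s. s \<in> {h - min d \<delta><..<h}) (at_left h)"
    using d(1) \<delta>(1) by (intro eventually_at_left_real) auto
  then show "eventually (\<lambda>s. windex (p s) = germ_index (p h) (- v)) (at_left h)"
  proof eventually_elim
    case (elim s)
    define w where "w = - ((p s - p h) / of_real (s - h))"
    have "p s = p h + of_real (h - s) * w" using elim by (simp add: w_def field_simps)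
    moreover have "norm ((p s - p h) / of_real (s - h) - v) \<le> \<delta> / 2" using elim by (intro quot) auto
    then have "norm (w - (- v)) < \<delta>1" using \<delta> unfolding w_def by (simp add: norm_minus_commute)
    moreover have "0 < h - s \<and> h - s < \<delta>1" using elim \<delta> by auto
    ultimately show ?case using \<delta>1(2) by metis
  qed
qed

lemma windex_locally_constant:
  assumes "z \<notin> support D"
  shows "\<exists>e>0. \<forall>w. dist w z < e \<longrightarrow> windex w = windex z"
proof -
  obtain e where e: "e > 0" "ball z e \<subseteq> - support D"
    using open_compl_support assms by (meson openE ComplI)
  have "connected_component (- support D) w z" if "dist w z < e" for w
    unfolding connected_component_def using e that
    by (intro exI[of _ "ball z e"]) (auto simp: dist_commute)
  then show ?thesis using e(1) windex_connected by blast
qed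

text \<open>Along the path \<open>windex\<close> changes only at the hits, where it drops by 1 from
  left to right and rises by 1 from right to left. These are the signs counted by the intersection
  number.\<close>

lemma intersection_number_eq:
  assumes p: "transverse_path D \<Delta> \<Delta>' p" and reg: "\<Delta> \<in> regions D" "\<Delta>' \<in> regions D"
  shows "intersection_number D p = windex (pathstart p) - windex (pathfinish p)"
proof -
  define H where "H = hits D p"
  have p': "path p" "p 0 \<in> \<Delta>" "p 1 \<in> \<Delta>'" "finite H"
    "\<And>s. s \<in> H \<Longrightarrow> p s \<notin> crossings D" "\<And>s. s \<in> H \<Longrightarrow> p differentiable (at s)"
    "\<And>s. s \<in> H \<Longrightarrow> wedge (tangent_at D (p s)) (vector_derivative p (at s)) \<noteq> 0"
    using p by (auto simp: transverse_path_def H_def pathstart_def pathfinish_def)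
  have "p 0 \<notin> support D" "p 1 \<notin> support D"
    using p'(2,3) reg in_components_subset unfolding regions_def by fastforce+
  then have H: "H \<subseteq> {0<..<1}" unfolding H_def hits_def by (auto simp: less_le)
  define V where "V s = vector_derivative p (at s)" for s
  have "windex (p 0) - windex (p 1) = (\<Sum>h\<in>H. germ_index (p h) (- V h) - germ_index (p h) (V h))"
  proof (rule sum_of_jumps[where f = "\<lambda>s. windex (p s)"])
    fix s assume s: "s \<in> {0..1} - H"
    then have "p s \<notin> support D" by (auto simp: H_def hits_def)
    then obtain e where e: "e > 0" "\<forall>w. dist w (p s) < e \<longrightarrow> windex w = windex (p s)"
      using windex_locally_constant by blast
    have "(p \<longlongrightarrow> p s) (at s within {0..1})"
      using p'(1) s unfolding path_def continuous_on_def by auto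
    then have "eventually (\<lambda>s'. dist (p s') (p s) < e) (at s within {0..1})"
      using e(1) by (rule tendstoD)
    then show "eventually (\<lambda>s'. windex (p s') = windex (p s)) (at s within {0..1})"
      by eventually_elim (use e(2) in blast)
  next
    fix h assume h: "h \<in> H"
    then have d: "(p has_vector_derivative V h) (at h)" using p'(6) by (simp add: V_def vector_derivative_works)
    have "p h \<in> support D" using h by (auto simp: H_def hits_def)
    then obtain q where q: "strands D (p h) = {q}" using strands_simple p'(5)[OF h] by blast
    have nz: "wedge (tangent D q') (V h) \<noteq> 0" if "q' \<in> strands D (p h)" for q'
      using p'(7)[OF h] q that by (simp add: tangent_at_def V_def)
    show "eventually (\<lambda>s. windex (p s) = germ_index (p h) (- V h)) (at_left h)"
      "eventually (\<lambda>s. windex (p s) = germ_index (p h) (V h)) (at_right h)"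
      using path_germ[OF d nz] by blast+
  qed (use H p'(4) in auto)
  also have "\<dots> = (\<Sum>h\<in>H. if right_of (tangent_at D (p h)) (V h) then 1 else - 1)"
  proof (intro sum.cong refl)
    fix h assume h: "h \<in> H"
    have "p h \<in> support D" using h by (auto simp: H_def hits_def)
    then obtain q where q: "strands D (p h) = {q}" using strands_simple p'(5)[OF h] by blast
    then have t: "tangent_at D (p h) = tangent D q" by (simp add: tangent_at_def)
    consider "wedge (tangent D q) (V h) < 0" | "wedge (tangent D q) (V h) > 0"
      using p'(7)[OF h] t unfolding V_def by fastforce
    then show "germ_index (p h) (- V h) - germ_index (p h) (V h) =
        (if right_of (tangent_at D (p h)) (V h) then 1 else - 1)"
    proof cases
      case 1
      then show ?thesis using germ_index_jump[OF q, of "- V h" "V h"] by (simp add: t right_of_def)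
    next
      case 2
      then show ?thesis using germ_index_jump[OF q, of "V h" "- V h"] by (simp add: t right_of_def)
    qed
  qed
  finally show ?thesis
    by (simp add: intersection_number_def H_def V_def pathstart_def pathfinish_def)
qed

lemma exterior_region:
  shows "exterior_region D \<in> regions D" "\<not> bounded (exterior_region D)"
    and exterior_region_unique: "\<And>\<Delta>. \<Delta> \<in> regions D \<Longrightarrow> \<not> bounded \<Delta> \<Longrightarrow> \<Delta> = exterior_region D"
proof -
  have b: "bounded (- (- support D))" using compact_support compact_imp_bounded by simp
  obtain c where c: "c \<in> regions D" "\<not> bounded c"
    using cobounded_unbounded_components[OF b] unfolding regions_def by blast
  have u: "\<Delta> = c" if "\<Delta> \<in> regions D" "\<not> bounded \<Delta>" for \<Delta>
    using cobounded_unique_unbounded_components[OF b] c that unfolding regions_def by simp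
  have ext: "exterior_region D = c"
    unfolding exterior_region_def
  proof (rule the_equality)
    show "c \<in> regions D \<and> \<not> bounded c" using c by blast
    show "\<Delta> = c" if "\<Delta> \<in> regions D \<and> \<not> bounded \<Delta>" for \<Delta> using that u by blast
  qed
  show "exterior_region D \<in> regions D" "\<not> bounded (exterior_region D)"
    unfolding ext by (rule c)+
  show "\<And>\<Delta>. \<Delta> \<in> regions D \<Longrightarrow> \<not> bounded \<Delta> \<Longrightarrow> \<Delta> = exterior_region D"
    unfolding ext by (rule u)
qed

end

text \<open>A nonzero derivative makes the points of the level isolated, and a compact interval
  cannot contain infinitely many points without accumulation.\<close>

lemma finite_regular_level:
  fixes g g' :: "real \<Rightarrow> real"
  assumes der: "\<And>t. (g has_real_derivative g' t) (at t)"
    and nz: "\<And>t. g t = c \<Longrightarrow> g' t \<noteq> 0"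
  shows "finite {t \<in> {a..b}. g t = c}"
proof -
  have "\<not> t islimpt {t. g t = c}" for t
  proof -
    have "((\<lambda>s. (g s - g t) / (s - t)) \<longlongrightarrow> g' t) (at t)"
      using der[of t] by (simp add: has_field_derivative_iff)
    moreover have "(g \<longlongrightarrow> g t) (at t)"
      using der[of t] DERIV_isCont isContD by blast
    ultimately have "eventually (\<lambda>s. g s \<noteq> c) (at t)"
    proof (cases "g t = c")
      case True
      assume "((\<lambda>s. (g s - g t) / (s - t)) \<longlongrightarrow> g' t) (at t)"
      then have "eventually (\<lambda>s. (g s - g t) / (s - t) \<noteq> 0) (at t)"
        using nz[OF True] by (rule tendsto_imp_eventually_ne)
      then show ?thesis by eventually_elim (use True in auto)
    next
      case False
      assume "(g \<longlongrightarrow> g t) (at t)"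
      then show ?thesis using False by (rule tendsto_imp_eventually_ne)
    qed
    then show ?thesis by (simp add: islimpt_iff_eventually)
  qed
  then have "finite ({a..b} \<inter> {t. g t = c})"
    by (rule finite_not_islimpt_in_compact[OF compact_Icc])
  moreover have "{a..b} \<inter> {t. g t = c} = {t \<in> {a..b}. g t = c}" by blast
  ultimately show ?thesis by (simp only:)
qed

context link_diagram
begin

lemma region_eqI:
  assumes "\<Delta> \<in> regions D" "\<Delta>' \<in> regions D" "z \<in> \<Delta>" "z \<in> \<Delta>'" shows "\<Delta> = \<Delta>'"
  using assms components_eq[of \<Delta> "- support D" \<Delta>'] unfolding regions_def by blast

text \<open>By Sard's theorem in dimension one, some vertical line through \<open>\<Delta>\<close> misses the crossings and is
  nowhere tangent to the diagram; its upper half is the path.\<close>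

lemma exists_transverse_path:
  assumes \<Delta>: "\<Delta> \<in> regions D"
  shows "\<exists>p. transverse_path D \<Delta> (exterior_region D) p"
proof -
  obtain w where w: "w \<in> \<Delta>" using \<Delta> in_components_nonempty unfolding regions_def by blast
  have "open \<Delta>" using \<Delta> open_compl_support open_components unfolding regions_def by blast
  then obtain e where e: "e > 0" "ball w e \<subseteq> \<Delta>" using w by (meson openE)
  have der: "((\<lambda>t. Re (curve D j t)) has_real_derivative Re (tangent D (j, t))) (at t)"
    if "j < ncomp D" for j t
    using bounded_linear.has_vector_derivative[OF bounded_linear_Re has_vector_derivative_curve[OF that]]
    by (simp add: has_real_derivative_iff_has_vector_derivative)
  have "\<exists>c. Re w - e < c \<and> c < Re w + e \<and> c \<notin> Re ` crossings D \<and>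
      (\<forall>j<ncomp D. \<forall>t. Re (curve D j t) = c \<longrightarrow> Re (tangent D (j, t)) \<noteq> 0)"
    using exists_regular_value[of "ncomp D" "\<lambda>j t. Re (curve D j t)" "\<lambda>j t. Re (tangent D (j, t))"
      "Re ` crossings D" "Re w - e" "Re w + e"] der finite_crossings e(1) by auto
  then obtain c where "Re w - e < c" "c < Re w + e" and c': "c \<notin> Re ` crossings D"
    "\<And>j t. j < ncomp D \<Longrightarrow> Re (curve D j t) = c \<Longrightarrow> Re (tangent D (j, t)) \<noteq> 0"
    by blast
  then have "\<bar>c - Re w\<bar> < e" by linarith
  note c = this c'
  define z where "z = Complex c (Im w)"
  have "dist w z = \<bar>c - Re w\<bar>" by (simp add: dist_norm z_def cmod_def abs_minus_commute)
  then have z: "z \<in> \<Delta>" using e(2) c(1) by auto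
  obtain B where B: "\<And>y. y \<in> support D \<Longrightarrow> norm y \<le> B"
    using compact_imp_bounded[OF compact_support] unfolding bounded_iff by blast
  \<comment> \<open>Long enough that the vertical ray from height \<open>M\<close> on stays outside
    the disc of radius \<open>B\<close>, which contains the diagram. The ray \<open>L\<close> then
    places the end of the path in the exterior region.\<close>
  define M where "M = \<bar>B\<bar> + norm z + 1"
  have M: "M > 0" by (simp add: M_def add_nonneg_pos)
  define p where "p s = z + of_real (s * M) * \<i>" for s :: real
  define L where "L = (\<lambda>r::real. z + of_real r * \<i>) ` {M..}"
  have far: "norm (z + of_real r * \<i>) > B" if "r \<ge> M" for r
  proof -
    have "r \<le> norm (z + of_real r * \<i>) + norm z"
      using norm_triangle_ineq4[of "z + of_real r * \<i>" z] M that by (simp add: norm_mult)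
    then show ?thesis using that by (simp add: M_def)
  qed
  define E where "E = connected_component_set (- support D) (z + of_real M * \<i>)"
  have L: "L \<subseteq> - support D" using B far unfolding L_def by (force simp: not_le)
  have cL: "connected L" unfolding L_def by (intro connected_continuous_image continuous_intros) auto
  have zL: "z + of_real M * \<i> \<in> L" by (simp add: L_def)
  have LE: "L \<subseteq> E" unfolding E_def by (rule connected_component_maximal[OF zL cL L])
  have "E \<in> regions D" unfolding E_def regions_def using zL L by (intro componentsI) auto
  moreover have "\<not> bounded E"
  proof
    assume "bounded E"
    then obtain b where b: "\<And>y. y \<in> E \<Longrightarrow> norm y \<le> b" unfolding bounded_iff by blast
    define r where "r = M + \<bar>b\<bar> + norm z"
    have "r \<ge> M" by (simp add: r_def)
    then have "norm (z + of_real r * \<i>) \<le> b" using LE by (intro b) (auto simp: L_def)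
    moreover have "r \<le> norm (z + of_real r * \<i>) + norm z"
      using norm_triangle_ineq4[of "z + of_real r * \<i>" z] M \<open>r \<ge> M\<close> by (simp add: norm_mult)
    ultimately show False using M by (simp add: r_def)
  qed
  ultimately have E: "E = exterior_region D" by (rule exterior_region_unique)
  have hit: "\<exists>j t. strands D (p s) = {(j, t)} \<and> j < ncomp D \<and> 0 \<le> t \<and> t < 1 \<and> curve D j t = p s \<and> Re (tangent D (j, t)) \<noteq> 0
      \<and> p s \<notin> crossings D" if s: "s \<in> hits D p" for s
  proof -
    have Re: "Re (p s) = c" by (simp add: p_def z_def)
    then have nc: "p s \<notin> crossings D" using c(2) by auto
    moreover have "p s \<in> support D" using s by (simp add: hits_def)
    ultimately obtain j t where jt: "strands D (p s) = {(j, t)}" using strands_simple by (metis surj_pair)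
    note j = strandsD[of j t "p s", unfolded jt, simplified]
    then show ?thesis using jt nc c(3)[of j t] Re by auto
  qed
  \<comment> \<open>A hit is recovered from the parameter on the diagram as its height above
    \<open>z\<close> divided by \<open>M\<close>; regularity of the value \<open>c\<close> leaves
    finitely many parameters.\<close>
  have "hits D p \<subseteq> (\<Union>j<ncomp D. (\<lambda>t. Im (curve D j t - z) / M) ` {t \<in> {0..1}. Re (curve D j t) = c})"
  proof
    fix s assume s: "s \<in> hits D p"
    obtain j t where jt: "j < ncomp D" "0 \<le> t" "t < 1" "curve D j t = p s" using hit[OF s] by blast
    have "s = Im (curve D j t - z) / M" using jt(4) M by (simp add: p_def)
    moreover have "Re (curve D j t) = c" using jt(4) by (simp add: p_def z_def)
    ultimately show "s \<in> (\<Union>j<ncomp D. (\<lambda>t. Im (curve D j t - z) / M) ` {t \<in> {0..1}. Re (curve D j t) = c})"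
      using jt by fastforce
  qed
  moreover have "finite {t \<in> {0..1}. Re (curve D j t) = c}" if "j < ncomp D" for j
    using finite_regular_level[OF der[OF that]] c(3)[OF that] by blast
  ultimately have fin: "finite (hits D p)" by (auto intro: finite_subset)
  have dp: "(p has_vector_derivative of_real M * \<i>) (at s)" for s
    unfolding p_def has_vector_derivative_def
    by (auto intro!: derivative_eq_intros simp: scaleR_conv_of_real algebra_simps)
  have "transverse_path D \<Delta> (exterior_region D) p"
    unfolding transverse_path_def
  proof (intro conjI ballI)
    show "path p" unfolding path_def p_def by (intro continuous_intros)
    show "pathstart p \<in> \<Delta>" using z by (simp add: pathstart_def p_def)
    show "pathfinish p \<in> exterior_region D" using LE zL by (auto simp: pathfinish_def p_def E[symmetric])
    show "finite (hits D p)" by (rule fin)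
    fix s assume s: "s \<in> hits D p"
    obtain j t where jt: "strands D (p s) = {(j, t)}" "Re (tangent D (j, t)) \<noteq> 0" "p s \<notin> crossings D"
      using hit[OF s] by blast
    show "p s \<notin> crossings D" by fact
    show "p differentiable at s" using dp by (rule differentiableI_vector)
    show "wedge (tangent_at D (p s)) (vector_derivative p (at s)) \<noteq> 0"
      unfolding vector_derivative_at[OF dp] tangent_at_def jt(1) the_elem_eq
      using jt(2) M by (simp add: wedge_def)
  qed
  then show ?thesis by blast
qed

text \<open>Every transverse path yields the same number, because \<open>windex\<close> vanishes at
  its exterior end, and at least one path exists; so the description in \<open>index\<close> has a
  unique solution.\<close>

lemma index_eq_windex:
  assumes "\<Delta> \<in> regions D" "z \<in> \<Delta>" shows "index D \<Delta> = windex z"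
proof -
  have eq: "intersection_number D p = windex z" if p: "transverse_path D \<Delta> (exterior_region D) p" for p
  proof -
    have "pathstart p \<in> \<Delta>" "pathfinish p \<in> exterior_region D"
      using p by (auto simp: transverse_path_def)
    then have "windex (pathfinish p) = 0" using windex_unbounded exterior_region by blast
    moreover have "connected_component (- support D) (pathstart p) z"
      using assms \<open>pathstart p \<in> \<Delta>\<close> unfolding regions_def connected_component_def
      by (meson in_components_connected in_components_subset)
    ultimately show ?thesis
      using intersection_number_eq[OF p assms(1) exterior_region(1)] windex_connected by auto
  qed
  obtain p where "transverse_path D \<Delta> (exterior_region D) p" using exists_transverse_path[OF assms(1)] by blast
  then show ?thesis unfolding index_def using eq by (intro the_equality) blast+
qed

text \<open>The directions to the right of both strands form a single sector, so their rays enter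
  one region, and any one direction \<open>w\<close> of the sector detects it.\<close>

lemma crossing_index_eq_germ_index:
  assumes x: "x \<in> crossings D"
    and w: "right_of (tangent D (over D x)) w" "right_of (tangent D (under D x)) w"
  shows "crossing_index D x = germ_index x w"
proof -
  note st = strands_crossing[OF x]
  have nz: "wedge (tangent D p) w \<noteq> 0" if "p \<in> strands D x" for p
    using that st w by (auto simp: right_of_def)
  obtain \<delta> where \<delta>: "\<delta> > 0" "\<And>r. 0 < r \<Longrightarrow> r < \<delta> \<Longrightarrow> x + of_real r * w \<notin> support D"
    "\<And>r. 0 < r \<Longrightarrow> r < \<delta> \<Longrightarrow> windex (x + of_real r * w) = germ_index x w"
  proof -
    obtain \<delta> where "\<delta> > 0" "\<forall>v r. norm (v - w) < \<delta> \<and> 0 < r \<and> r < \<delta> \<longrightarrow>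
        x + of_real r * v \<notin> support D \<and> windex (x + of_real r * v) = germ_index x w"
      using germ_index_ball[OF nz] by blast
    then show ?thesis using that[of \<delta>] by simp
  qed
  define z where "z = x + of_real (\<delta> / 2) * w"
  define \<Delta> where "\<Delta> = connected_component_set (- support D) z"
  have zS: "z \<notin> support D" "windex z = germ_index x w"
    unfolding z_def using \<delta>(1) \<delta>(2)[of "\<delta> / 2"] \<delta>(3)[of "\<delta> / 2"] by simp_all
  then have \<Delta>: "\<Delta> \<in> regions D" "z \<in> \<Delta>"
    unfolding \<Delta>_def regions_def by (auto intro: componentsI)
  have in\<Delta>: "eventually (\<lambda>r. x + of_real r * w' \<in> \<Delta>) (at_right 0)"
    if w': "right_of (tangent D (over D x)) w'" "right_of (tangent D (under D x)) w'" for w'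
  proof -
    have "wedge (tangent D p) w * wedge (tangent D p) w' > 0" if "p \<in> strands D x" for p
      using that st w w' by (auto simp: right_of_def mult_neg_neg)
    then obtain \<delta>' where \<delta>': "\<delta>' > 0" "\<And>r r'. 0 < r \<Longrightarrow> r < \<delta>' \<Longrightarrow> 0 < r' \<Longrightarrow> r' < \<delta>' \<Longrightarrow>
        connected_component (- support D) (x + of_real r * w) (x + of_real r' * w')"
      using same_sign_connected[of x w w'] by blast

    have line: "connected_component (- support D) z (x + of_real r * w)" if "0 < r" "r < \<delta>" for r
    proof -
      let ?L = "(\<lambda>r. x + of_real r * w) ` {0<..<\<delta>}"
      have "connected ?L" by (intro connected_continuous_image continuous_intros) auto
      moreover have "?L \<subseteq> - support D" using \<delta>(2) by auto
      moreover have "z \<in> ?L" unfolding z_def by (rule imageI) (use \<delta>(1) in simp)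
      moreover have "x + of_real r * w \<in> ?L" by (rule imageI) (use that in simp)
      ultimately show ?thesis unfolding connected_component_def by blast
    qed
    have "min \<delta> \<delta>' > 0" using \<delta>(1) \<delta>'(1) by simp
    from eventually_at_right_real[OF this] show ?thesis
    proof eventually_elim
      case (elim r)
      then have "connected_component (- support D) z (x + of_real r * w)"
        "connected_component (- support D) (x + of_real r * w) (x + of_real r * w')"
        using line \<delta>'(2) by auto
      then show ?case unfolding \<Delta>_def by (auto intro: connected_component_trans)
    qed
  qed
  have "source_region D x = \<Delta>"
    unfolding source_region_def
  proof (rule the_equality)
    fix \<Delta>' assume \<Delta>': "\<Delta>' \<in> regions D \<and> (\<forall>w. right_of (tangent D (over D x)) w \<and> right_of (tangent D (under D x)) w \<longrightarrow>
        (\<forall>\<^sub>F r in at_right 0. x + complex_of_real r * w \<in> \<Delta>'))"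
    then have "eventually (\<lambda>r. x + of_real r * w \<in> \<Delta>') (at_right 0)" using w by blast
    then have "eventually (\<lambda>r. x + of_real r * w \<in> \<Delta>' \<and> x + of_real r * w \<in> \<Delta>) (at_right 0)"
      using in\<Delta>[OF w] by eventually_elim simp
    then obtain r :: real where "x + of_real r * w \<in> \<Delta>'" "x + of_real r * w \<in> \<Delta>"
      using eventually_happens'[of "at_right (0::real)"] by fastforce
    then show "\<Delta>' = \<Delta>" using region_eqI \<Delta>' \<Delta>(1) by blast
  qed (use \<Delta>(1) in\<Delta> in blast)
  then show ?thesis unfolding crossing_index_def using index_eq_windex[OF \<Delta>] zS by simp
qed

end


section \<open>The index along a strand\<close>

text \<open>The unsimplified \<open>1 * h\<close> and \<open>(- 1) * h\<close> are the two instances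
  of \<sigma> h in the lemmas that treat both sides of a parameter at once.\<close>

lemma at_right_left_0:
  shows "eventually P (at_right t) \<longleftrightarrow> eventually (\<lambda>h. P (t + 1 * h)) (at_right (0::real))"
    and "eventually P (at_left t) \<longleftrightarrow> eventually (\<lambda>h. P (t + (- 1) * h)) (at_right (0::real))"
proof -
  show "eventually P (at_right t) \<longleftrightarrow> eventually (\<lambda>h. P (t + 1 * h)) (at_right (0::real))"
    by (subst at_right_to_0) (simp add: eventually_filtermap add.commute)
  show "eventually P (at_left t) \<longleftrightarrow> eventually (\<lambda>h. P (t + (- 1) * h)) (at_right (0::real))"
    by (subst at_left_minus, subst at_right_to_0) (simp add: eventually_filtermap add.commute)
qed

text \<open>A periodic function returns to its initial value. A jump at 0 would sit at both ends of
  the period, so \<open>g\<close> takes the right-hand value at 0 and the left-hand value at 1; its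
  total change then accounts for that jump.\<close>

lemma sum_of_jumps_periodic:
  fixes f :: "real \<Rightarrow> 'b::ab_group_add"
  assumes per: "\<And>t. f (t + 1) = f t" and T: "finite T" "T \<subseteq> {0..<1}"
    and const: "\<And>t. t \<in> {0..<1} - T \<Longrightarrow> eventually (\<lambda>s. f s = f t) (at t)"
    and left: "\<And>t. t \<in> T \<Longrightarrow> eventually (\<lambda>s. f s = L t) (at_left t)"
    and right: "\<And>t. t \<in> T \<Longrightarrow> eventually (\<lambda>s. f s = R t) (at_right t)"
  shows "(\<Sum>t\<in>T. L t - R t) = 0"
proof -
  define r where "r = (if 0 \<in> T then R 0 else f 0)"
  define l where "l = (if 0 \<in> T then L 0 else f 0)"
  define g where "g s = (if s = 0 then r else if s = 1 then l else f s)" for s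
  have c0: "eventually (\<lambda>s. f s = f 0) (at 0)" if "0 \<notin> T" using const[of 0] that by simp
  have fr: "eventually (\<lambda>s. f s = r) (at_right 0)"
    using right[of 0] c0 by (auto simp: r_def eventually_at_split)
  have "eventually (\<lambda>s. f s = l) (at_left 0)"
    using left[of 0] c0 by (auto simp: l_def eventually_at_split)
  then obtain b where b: "b < 0" "\<And>y. y > b \<Longrightarrow> y < 0 \<Longrightarrow> f y = l"
    unfolding eventually_at_left_field by blast
  have fl: "eventually (\<lambda>s. f s = l) (at_left 1)"
    unfolding eventually_at_left_field
  proof (intro exI[of _ "b + 1"] conjI allI impI)
    fix y assume y: "b + 1 < y" "y < 1"
    have "f (y - 1) = l" using y by (intro b(2)) auto
    then show "f y = l" using per[of "y - 1"] by simp
  qed (use b(1) in simp)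
  have inner: "eventually (\<lambda>s. s \<in> {0<..<1}) (at t)" if "t \<in> {0<..<1}" for t :: real
    using that eventually_at_in_open'[of "{0<..<1}" t] by simp
  have "g 0 - g 1 = (\<Sum>t\<in>T - {0}. L t - R t)"
  proof (rule sum_of_jumps)
    fix s assume s: "s \<in> {0..1} - (T - {0})"
    then consider "s = 0" | "s = 1" | "s \<in> {0<..<1}" "s \<in> {0..<1} - T" by fastforce
    then show "eventually (\<lambda>s'. g s' = g s) (at s within {0..1})"
    proof cases
      case 1
      have "eventually (\<lambda>s. s \<in> {0<..<1}) (at_right (0::real))" by (rule eventually_at_right_real) simp
      with fr have "eventually (\<lambda>s'. g s' = g 0) (at_right 0)"
        by eventually_elim (auto simp: g_def)
      then show ?thesis using 1 by (simp add: at_within_Icc_at_right)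
    next
      case 2
      have "eventually (\<lambda>s. s \<in> {0<..<1}) (at_left (1::real))" by (rule eventually_at_left_real) simp
      with fl have "eventually (\<lambda>s'. g s' = g 1) (at_left 1)"
        by eventually_elim (auto simp: g_def)
      then show ?thesis using 2 by (simp add: at_within_Icc_at_left)
    next
      case 3
      have "eventually (\<lambda>s'. g s' = g s) (at s)"
        using const[OF 3(2)] inner[OF 3(1)] by eventually_elim (use 3(1) in \<open>auto simp: g_def\<close>)
      then show ?thesis by (rule filter_leD[OF at_le, rotated]) auto
    qed
  next
    fix h assume h: "h \<in> T - {0}"
    then have in1: "h \<in> {0<..<1}" using T(2) by fastforce
    have i: "eventually (\<lambda>s. s \<in> {0<..<1}) (at_left h)" "eventually (\<lambda>s. s \<in> {0<..<1}) (at_right h)"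
      using inner[OF in1] unfolding eventually_at_split by auto
    have "h \<in> T" using h by simp
    show "eventually (\<lambda>s. g s = L h) (at_left h)"
      using left[OF \<open>h \<in> T\<close>] i(1) by eventually_elim (auto simp: g_def)
    show "eventually (\<lambda>s. g s = R h) (at_right h)"
      using right[OF \<open>h \<in> T\<close>] i(2) by eventually_elim (auto simp: g_def)
  qed (use T in \<open>auto simp: less_le\<close>)
  moreover have "g 0 - g 1 = r - l" by (simp add: g_def)
  ultimately show ?thesis
    using T(1) by (cases "0 \<in> T") (auto simp: r_def l_def sum.remove algebra_simps)
qed

section \<open>The right-hand index near a point of a strand and near a crossing\<close>

context link_diagram
begin

lemma eventually_curve_neq:
  assumes j: "j < ncomp D" shows "eventually (\<lambda>t. curve D j t \<noteq> c) (at t0)"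
proof (cases "curve D j t0 = c")
  case False
  have "(curve D j \<longlongrightarrow> curve D j t0) (at t0)"
    using continuous_on_curve[OF j, of UNIV] by (simp add: continuous_on_def)
  then show ?thesis using False by (rule tendsto_imp_eventually_ne)
next
  case True
  define u where "u = tangent D (j, t0)"
  have u: "norm u / 2 > 0" using tangent_nz[OF j] by (simp add: u_def)
  then obtain d where d: "d > 0" "\<And>s t. \<bar>s - t0\<bar> < d \<Longrightarrow> \<bar>t - t0\<bar> < d \<Longrightarrow>
      norm (curve D j s - curve D j t - of_real (s - t) * u) \<le> norm u / 2 * \<bar>s - t\<bar>"
    using strict_derivative[OF j, of "norm u / 2" t0] unfolding u_def by blast
  have "curve D j t \<noteq> c" if "t \<noteq> t0" "dist t t0 < d" for t
  proof
    assume "curve D j t = c"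
    then have "norm (of_real (t - t0) * u) \<le> norm u / 2 * \<bar>t - t0\<bar>"
      using d(2)[of t t0] d(1) that(2) True by (simp add: dist_real_def)
    then have "\<bar>t - t0\<bar> * norm u \<le> \<bar>t - t0\<bar> * (norm u / 2)"
      by (simp only: norm_mult norm_of_real mult.commute)
    moreover have "\<bar>t - t0\<bar> > 0" using that(1) by simp
    ultimately have "norm u \<le> norm u / 2" by (simp only: mult_le_cancel_left_pos)
    then show False using u by simp
  qed
  then show ?thesis using d(1) unfolding eventually_at by blast
qed

lemma eventually_not_crossing:
  assumes "j < ncomp D" shows "eventually (\<lambda>t. curve D j t \<notin> crossings D) (at t0)"
proof -
  have "eventually (\<lambda>t. \<forall>c\<in>crossings D. curve D j t \<noteq> c) (at t0)"
    using finite_crossings eventually_curve_neq[OF assms] by (intro eventually_ball_finite) auto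
  then show ?thesis by eventually_elim auto
qed

lemma strands_not_crossing:
  assumes "j < ncomp D" "curve D j t \<notin> crossings D"
  shows "strands D (curve D j t) = {(j, frac t)}"
proof -
  have "curve D j t \<in> support D" using assms(1) by (auto simp: support_def)
  then obtain p where "strands D (curve D j t) = {p}" using strands_simple assms(2) by blast
  then show ?thesis using strandsI[OF assms(1), of t] by auto
qed

text \<open>At a crossing the right normal may point along the other strand, so the statements about
  crossings below concern only nearby parameters.\<close>

definition right_index :: "nat \<Rightarrow> real \<Rightarrow> int" where
  "right_index j t = germ_index (curve D j t) (- (\<i> * tangent D (j, t)))"

lemma right_index_add_1: "j < ncomp D \<Longrightarrow> right_index j (t + 1) = right_index j t"
  using tangent_add_int[of j t 1] by (simp add: right_index_def curve_add_1)

lemma germ_index_strand: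
  assumes j: "j < ncomp D" "curve D j t \<notin> crossings D"
  shows "wedge (tangent D (j, t)) V < 0 \<Longrightarrow> germ_index (curve D j t) V = right_index j t"
    and "wedge (tangent D (j, t)) V > 0 \<Longrightarrow> germ_index (curve D j t) V = right_index j t + 1"
proof -
  let ?u = "tangent D (j, t)"
  note st = strands_not_crossing[OF j]
  have t: "tangent D (j, frac t) = ?u" by (rule tangent_frac[OF j(1)])
  have u: "wedge ?u (- (\<i> * ?u)) < 0" using tangent_nz[OF j(1)] by (simp add: wedge_perp)
  show "germ_index (curve D j t) V = right_index j t" if "wedge ?u V < 0"
    unfolding right_index_def
  proof (rule germ_index_cong)
    fix p assume "p \<in> strands D (curve D j t)"
    then have "tangent D p = ?u" using st t by auto
    then show "wedge (tangent D p) V * wedge (tangent D p) (- (\<i> * ?u)) > 0"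
      using mult_neg_neg[OF that u] by (simp only:)
  qed
  show "germ_index (curve D j t) V = right_index j t + 1" if "wedge ?u V > 0"
    unfolding right_index_def using that u t by (intro germ_index_jump[OF st]) simp_all
qed

lemma germ_index_near_strand:
  assumes p: "(j, t0) \<in> strands D x" and \<sigma>: "\<bar>\<sigma>\<bar> = 1"
    and V: "wedge (tangent D (j, t0)) V \<noteq> 0"
    and other: "\<And>p \<tau>. p \<in> strands D x \<Longrightarrow> p \<noteq> (j, t0) \<Longrightarrow> 0 \<le> \<tau> \<Longrightarrow> \<tau> \<le> 1 \<Longrightarrow>
        wedge (tangent D p) (of_real \<sigma> * tangent D (j, t0) + of_real \<tau> * V) \<noteq> 0"
  shows "eventually (\<lambda>h. germ_index (curve D j (t0 + \<sigma> * h)) V =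
      germ_index x (of_real \<sigma> * tangent D (j, t0) + V)) (at_right 0)"
proof -
  let ?w = "of_real \<sigma> * tangent D (j, t0) + V"
  obtain \<delta> where \<delta>: "\<delta> > 0" "\<And>h \<tau> r. 0 < h \<Longrightarrow> h < \<delta> \<Longrightarrow> 0 < \<tau> \<Longrightarrow> \<tau> \<le> 1 \<Longrightarrow> 0 < r \<Longrightarrow> r < \<delta> \<Longrightarrow>
        connected_component (- support D) (curve D j (t0 + \<sigma> * h) + of_real (\<tau> * h) * V) (x + of_real r * ?w)"
    using strand_side_germ[OF p \<sigma> V other] by blast
  have "wedge (tangent D p) ?w \<noteq> 0" if "p \<in> strands D x" for p
    using V other[OF that, of 1] by (cases "p = (j, t0)") (auto simp: wedge_add_right)
  then have "eventually (\<lambda>r. windex (x + of_real r * ?w) = germ_index x ?w) (at_right 0)"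
    by (rule eventually_germ_index)
  moreover have "eventually (\<lambda>r. r \<in> {0<..<\<delta>}) (at_right 0)" by (rule eventually_at_right_real[OF \<delta>(1)])
  ultimately have "eventually (\<lambda>r. r \<in> {0<..<\<delta>} \<and> windex (x + of_real r * ?w) = germ_index x ?w) (at_right 0)"
    by eventually_elim blast
  then obtain r where r: "r \<in> {0<..<\<delta>}" "windex (x + of_real r * ?w) = germ_index x ?w"
    using eventually_happens'[of "at_right (0::real)"] trivial_limit_at_right_real by blast
  show ?thesis
    using eventually_at_right_real[OF \<delta>(1)]
  proof eventually_elim
    case (elim h)
    show ?case
    proof (rule germ_index_eqI)
      have "0 < h" using elim by simp
      from eventually_at_right_real[OF this]
      show "eventually (\<lambda>a. windex (curve D j (t0 + \<sigma> * h) + of_real a * V) = germ_index x ?w) (at_right 0)"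
      proof eventually_elim
        case (elim a)
        \<comment> \<open>Here \<open>a / h\<close> plays the part of \<tau>; it is at most 1
          because a < h.\<close>
        have "connected_component (- support D) (curve D j (t0 + \<sigma> * h) + of_real (a / h * h) * V) (x + of_real r * ?w)"
          using elim \<open>h \<in> {0<..<\<delta>}\<close> r(1) by (intro \<delta>(2)) auto
        then show ?case using windex_connected r(2) \<open>0 < h\<close> by simp
      qed
    qed
  qed
qed

text \<open>By continuity \<open>V\<close> stays on the same side of all nearby tangents, so it can
  replace their normals. This freedom in \<open>V\<close> is what makes crossings
  accessible.\<close>

lemma right_index_near_strand:
  assumes p: "(j, t0) \<in> strands D x" and \<sigma>: "\<bar>\<sigma>\<bar> = 1"
    and other: "\<And>p \<tau>. p \<in> strands D x \<Longrightarrow> p \<noteq> (j, t0) \<Longrightarrow> 0 \<le> \<tau> \<Longrightarrow> \<tau> \<le> 1 \<Longrightarrow>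
        wedge (tangent D p) (of_real \<sigma> * tangent D (j, t0) + of_real \<tau> * V) \<noteq> 0"
  shows "wedge (tangent D (j, t0)) V < 0 \<Longrightarrow> eventually (\<lambda>h. right_index j (t0 + \<sigma> * h) =
      germ_index x (of_real \<sigma> * tangent D (j, t0) + V)) (at_right 0)"
    and "wedge (tangent D (j, t0)) V > 0 \<Longrightarrow> eventually (\<lambda>h. right_index j (t0 + \<sigma> * h) + 1 =
      germ_index x (of_real \<sigma> * tangent D (j, t0) + V)) (at_right 0)"
proof -
  note j = strandsD[OF p]
  have lim: "filterlim (\<lambda>h. t0 + \<sigma> * h) (at t0) (at_right 0)"
  proof (rule filterlim_atI)
    have "((\<lambda>h. t0 + \<sigma> * h) \<longlongrightarrow> t0 + \<sigma> * 0) (at_right 0)" by (intro tendsto_intros)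
    then show "((\<lambda>h. t0 + \<sigma> * h) \<longlongrightarrow> t0) (at_right 0)" by simp
    show "eventually (\<lambda>h. t0 + \<sigma> * h \<noteq> t0) (at_right 0)"
      using eventually_at_right_less[of "0::real"] by eventually_elim (use \<sigma> in auto)
  qed
  have nc: "eventually (\<lambda>h. curve D j (t0 + \<sigma> * h) \<notin> crossings D) (at_right 0)"
    using eventually_compose_filterlim[OF eventually_not_crossing[OF j(1)] lim] .
  have "continuous_on UNIV (\<lambda>t. wedge (tangent D (j, t)) V)"
    by (intro continuous_intros continuous_on_tangent j)
  then have "((\<lambda>t. wedge (tangent D (j, t)) V) \<longlongrightarrow> wedge (tangent D (j, t0)) V) (at t0)"
    by (simp add: continuous_on_def)
  then have wl: "((\<lambda>h. wedge (tangent D (j, t0 + \<sigma> * h)) V) \<longlongrightarrow> wedge (tangent D (j, t0)) V) (at_right 0)"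
    using lim by (rule filterlim_compose)
  show "eventually (\<lambda>h. right_index j (t0 + \<sigma> * h) =
      germ_index x (of_real \<sigma> * tangent D (j, t0) + V)) (at_right 0)" if V: "wedge (tangent D (j, t0)) V < 0"
  proof -
    have "eventually (\<lambda>h. germ_index (curve D j (t0 + \<sigma> * h)) V =
      germ_index x (of_real \<sigma> * tangent D (j, t0) + V)) (at_right 0)"
      using V by (intro germ_index_near_strand[OF p \<sigma> _ other]) auto
    with nc order_tendstoD(2)[OF wl V] show ?thesis
      by eventually_elim (use germ_index_strand(1)[OF j(1)] in auto)
  qed
  show "eventually (\<lambda>h. right_index j (t0 + \<sigma> * h) + 1 =
      germ_index x (of_real \<sigma> * tangent D (j, t0) + V)) (at_right 0)" if V: "wedge (tangent D (j, t0)) V > 0"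
  proof -
    have "eventually (\<lambda>h. germ_index (curve D j (t0 + \<sigma> * h)) V =
      germ_index x (of_real \<sigma> * tangent D (j, t0) + V)) (at_right 0)"
      using V by (intro germ_index_near_strand[OF p \<sigma> _ other]) auto
    with nc order_tendstoD(1)[OF wl V] show ?thesis
      by eventually_elim (use germ_index_strand(2)[OF j(1)] in auto)
  qed
qed

lemma right_index_locally_constant:
  assumes j: "j < ncomp D" and t: "0 \<le> t" "t < 1" "curve D j t \<notin> crossings D"
  shows "eventually (\<lambda>s. right_index j s = right_index j t) (at t)"
proof -
  let ?x = "curve D j t" and ?u = "tangent D (j, t)"
  let ?V = "- (\<i> * ?u)"
  have fr: "frac t = t" using t by (simp add: frac_eq)
  have st: "strands D ?x = {(j, t)}" using strands_not_crossing[OF j t(3)] fr by simp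
  have V: "wedge ?u ?V < 0" using tangent_nz[OF j] by (simp add: wedge_perp)
  have "eventually (\<lambda>h. right_index j (t + \<sigma> * h) = right_index j t) (at_right 0)" if \<sigma>: "\<bar>\<sigma>\<bar> = 1" for \<sigma>
  proof -
    have "eventually (\<lambda>h. right_index j (t + \<sigma> * h) = germ_index ?x (of_real \<sigma> * ?u + ?V)) (at_right 0)"
      using st V \<sigma> by (intro right_index_near_strand(1)) auto
    moreover have "wedge ?u (of_real \<sigma> * ?u + ?V) < 0"
      unfolding wedge_add_right using V by simp
    then have "germ_index ?x (of_real \<sigma> * ?u + ?V) = right_index j t"
      by (rule germ_index_strand(1)[OF j t(3)])
    ultimately show ?thesis by simp
  qed
  from this[of 1] this[of "- 1"] show ?thesis
    unfolding eventually_at_split at_right_left_0[where t = t] by simp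
qed

text \<open>With \<open>V\<close> a multiple of the other tangent, the wedge of that tangent with
  \<sigma> u + \<tau> V does not depend on \<tau>, so the transversality demanded for all \<tau>
  reduces to that of the crossing.\<close>

lemma right_index_near_crossing:
  assumes x: "strands D x = {(j, t0), q}" "(j, t0) \<noteq> q" and \<sigma>: "\<bar>\<sigma>\<bar> = 1"
    and nz: "wedge (tangent D (j, t0)) (tangent D q) \<noteq> 0"
  shows "c * wedge (tangent D (j, t0)) (tangent D q) < 0 \<Longrightarrow>
      eventually (\<lambda>h. right_index j (t0 + \<sigma> * h) =
        germ_index x (of_real \<sigma> * tangent D (j, t0) + of_real c * tangent D q)) (at_right 0)"
    and "c * wedge (tangent D (j, t0)) (tangent D q) > 0 \<Longrightarrow>
      eventually (\<lambda>h. right_index j (t0 + \<sigma> * h) + 1 =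
        germ_index x (of_real \<sigma> * tangent D (j, t0) + of_real c * tangent D q)) (at_right 0)"
proof -
  have p: "(j, t0) \<in> strands D x" using x by simp
  have other: "wedge (tangent D p) (of_real \<sigma> * tangent D (j, t0) + of_real \<tau> * (of_real c * tangent D q)) \<noteq> 0"
    if "p \<in> strands D x" "p \<noteq> (j, t0)" for p \<tau>
  proof -
    have "p = q" using that x by auto
    then show ?thesis using nz \<sigma> wedge_commute[of "tangent D q" "tangent D (j, t0)"]
      by (auto simp: wedge_add_right)
  qed
  show "eventually (\<lambda>h. right_index j (t0 + \<sigma> * h) =
        germ_index x (of_real \<sigma> * tangent D (j, t0) + of_real c * tangent D q)) (at_right 0)"
    if "c * wedge (tangent D (j, t0)) (tangent D q) < 0"
    by (rule right_index_near_strand(1)[OF p \<sigma>]) (use other that in auto)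
  show "eventually (\<lambda>h. right_index j (t0 + \<sigma> * h) + 1 =
        germ_index x (of_real \<sigma> * tangent D (j, t0) + of_real c * tangent D q)) (at_right 0)"
    if "c * wedge (tangent D (j, t0)) (tangent D q) > 0"
    by (rule right_index_near_strand(2)[OF p \<sigma>]) (use other that in auto)
qed

text \<open>Both sectors are also seen from simple points of \<open>p\<close> close to the crossing,
  as its right and left side, and there the jump is known.\<close>

lemma germ_index_across:
  assumes x: "strands D x = {p, q}" "p \<noteq> q" and \<sigma>: "\<bar>\<sigma>\<bar> = 1"
    and c: "c * wedge (tangent D p) (tangent D q) < 0"
  shows "germ_index x (of_real \<sigma> * tangent D p - of_real c * tangent D q) =
    germ_index x (of_real \<sigma> * tangent D p + of_real c * tangent D q) + 1"
proof -
  obtain j t0 where p: "p = (j, t0)" by force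
  have nz: "wedge (tangent D p) (tangent D q) \<noteq> 0" using c by auto
  have "eventually (\<lambda>h. right_index j (t0 + \<sigma> * h) =
        germ_index x (of_real \<sigma> * tangent D p + of_real c * tangent D q)) (at_right 0)"
    using right_index_near_crossing(1)[of x j t0 q \<sigma> c] x \<sigma> c nz unfolding p by blast
  moreover have "eventually (\<lambda>h. right_index j (t0 + \<sigma> * h) + 1 =
        germ_index x (of_real \<sigma> * tangent D p + of_real (- c) * tangent D q)) (at_right 0)"
    using right_index_near_crossing(2)[of x j t0 q \<sigma> "- c"] x \<sigma> c nz unfolding p by simp
  ultimately have "eventually (\<lambda>h::real. germ_index x (of_real \<sigma> * tangent D p - of_real c * tangent D q) =
    germ_index x (of_real \<sigma> * tangent D p + of_real c * tangent D q) + 1) (at_right 0)"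
    by eventually_elim simp
  then show ?thesis by (simp add: eventually_const)
qed

text \<open>The four sectors are represented by the sums of plus or minus the two tangents. The sign
  of \<open>W\<close> decides which multiple of one tangent lies to the right of the other strand;
  \<sigma> = -1 and \<sigma> = 1 are the times before and after the crossing.\<close>

lemma right_index_at_crossing:
  assumes x: "x \<in> crossings D" and over: "over D x = (jo, to)" and under: "under D x = (ju, tu)"
  defines "n \<equiv> crossing_index D x"
    and "W \<equiv> wedge (tangent D (over D x)) (tangent D (under D x))"
  shows "W > 0 \<Longrightarrow>
      eventually (\<lambda>s. right_index jo s = n + 1) (at_left to) \<and> eventually (\<lambda>s. right_index jo s = n) (at_right to) \<and>
      eventually (\<lambda>s. right_index ju s = n) (at_left tu) \<and> eventually (\<lambda>s. right_index ju s = n + 1) (at_right tu)"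
    and "W < 0 \<Longrightarrow>
      eventually (\<lambda>s. right_index jo s = n) (at_left to) \<and> eventually (\<lambda>s. right_index jo s = n + 1) (at_right to) \<and>
      eventually (\<lambda>s. right_index ju s = n + 1) (at_left tu) \<and> eventually (\<lambda>s. right_index ju s = n) (at_right tu)"
proof -
  define o' u where "o' = tangent D (over D x)" and "u = tangent D (under D x)"
  note st = strands_crossing[OF x]
  have st': "strands D x = {under D x, over D x}" "over D x \<noteq> under D x" using st by auto
  have wc: "wedge u o' = - W" unfolding W_def o'_def u_def by (rule wedge_commute)
  have W: "wedge o' u = W" by (simp add: W_def o'_def u_def)
  note ou = o'_def[symmetric] u_def[symmetric]
  have near_over: "eventually (\<lambda>h. right_index jo (to + \<sigma> * h) = germ_index x (of_real \<sigma> * o' + of_real c * u)) (at_right 0)"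
    if "\<bar>\<sigma>\<bar> = 1" "c * W < 0" for \<sigma> c
  proof -
    have "wedge o' u \<noteq> 0" using that(2) W by auto
    then show ?thesis
      using right_index_near_crossing(1)[of x jo to "under D x" \<sigma> c] st that W
      unfolding over[symmetric] ou by auto
  qed
  have near_under: "eventually (\<lambda>h. right_index ju (tu + \<sigma> * h) = germ_index x (of_real \<sigma> * u + of_real c * o')) (at_right 0)"
    if "\<bar>\<sigma>\<bar> = 1" "c * W > 0" for \<sigma> c
  proof -
    have "wedge u o' \<noteq> 0" using that(2) wc by auto
    then show ?thesis
      using right_index_near_crossing(1)[of x ju tu "over D x" \<sigma> c] st' that wc
      unfolding under[symmetric] ou by auto
  qed
  have across_over: "germ_index x (of_real \<sigma> * o' - of_real c * u) = germ_index x (of_real \<sigma> * o' + of_real c * u) + 1"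
    if "\<bar>\<sigma>\<bar> = 1" "c * W < 0" for \<sigma> c
    using germ_index_across[OF st(1) st(2)[symmetric] that(1)] that(2) W unfolding ou by auto
  have across_under: "germ_index x (of_real \<sigma> * u - of_real c * o') = germ_index x (of_real \<sigma> * u + of_real c * o') + 1"
    if "\<bar>\<sigma>\<bar> = 1" "c * W > 0" for \<sigma> c
    using germ_index_across[OF st' (1) st'(2)[symmetric] that(1), of c] that(2) wc unfolding ou by auto
  have comm: "- u - o' = - o' - u" by simp
  {
    assume pos: "W > 0"
    \<comment> \<open>Both wedges with \<open>o' - u\<close> equal - W, so this direction points to
      the right of both strands. For negative \<open>W\<close> the opposite direction does.\<close>
    have n: "n = germ_index x (o' - u)"
      unfolding n_def using pos W wc
      by (intro crossing_index_eq_germ_index[OF x]) (auto simp: ou right_of_def wedge_def algebra_simps)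
    have "germ_index x (- o' - u) = n + 1" "germ_index x (o' + u) = n + 1"
      using across_under[of "- 1" 1] across_over[of 1 "- 1"] pos by (simp_all add: n add.commute comm)
    then show "eventually (\<lambda>s. right_index jo s = n + 1) (at_left to) \<and> eventually (\<lambda>s. right_index jo s = n) (at_right to) \<and>
      eventually (\<lambda>s. right_index ju s = n) (at_left tu) \<and> eventually (\<lambda>s. right_index ju s = n + 1) (at_right tu)"
      using near_over[of "- 1" "- 1"] near_over[of 1 "- 1"] near_under[of "- 1" 1] near_under[of 1 1] pos
      unfolding at_right_left_0[where t = to] at_right_left_0[where t = tu]
      by (simp add: n algebra_simps)
  }
  {
    assume neg: "W < 0"
    have n: "n = germ_index x (u - o')"
      unfolding n_def using neg W wc
      by (intro crossing_index_eq_germ_index[OF x]) (auto simp: ou right_of_def wedge_def algebra_simps)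
    have "germ_index x (- o' - u) = n + 1" "germ_index x (u + o') = n + 1"
      using across_over[of "- 1" 1] across_under[of 1 "- 1"] neg by (simp_all add: n add.commute comm)
    then show "eventually (\<lambda>s. right_index jo s = n) (at_left to) \<and> eventually (\<lambda>s. right_index jo s = n + 1) (at_right to) \<and>
      eventually (\<lambda>s. right_index ju s = n + 1) (at_left tu) \<and> eventually (\<lambda>s. right_index ju s = n) (at_right tu)"
      using near_over[of "- 1" 1] near_over[of 1 1] near_under[of "- 1" "- 1"] near_under[of 1 "- 1"] neg
      unfolding at_right_left_0[where t = to] at_right_left_0[where t = tu]
      by (simp add: n algebra_simps)
  }
qed


section \<open>Arcs\<close>

lemma under_params_add_int:
  assumes "j < ncomp D" shows "t + of_int k \<in> under_params D j \<longleftrightarrow> t \<in> under_params D j"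
  using curve_add_int[OF assms, of t k] by (simp add: under_params_def frac_add_of_int_right)

lemma not_crossing_not_under_params: "curve D j t \<notin> crossings D \<Longrightarrow> t \<notin> under_params D j"
  by (simp add: under_params_def)

lemma connected_params_add_int:
  assumes j: "j < ncomp D" and c: "connected_component (- under_params D j) a b"
  shows "connected_component (- under_params D j) (a + of_int k) (b + of_int k)"
proof -
  obtain T where T: "connected T" "T \<subseteq> - under_params D j" "a \<in> T" "b \<in> T"
    using c unfolding connected_component_def by blast
  have "connected ((\<lambda>t. t + of_int k) ` T)"
    using T(1) by (intro connected_continuous_image continuous_intros)
  then show ?thesis unfolding connected_component_def
    using T under_params_add_int[OF j] by (intro exI[of _ "(\<lambda>t. t + of_int k) ` T"]) auto
qed

lemma arc_through_subset:
  assumes j: "j < ncomp D" and c: "connected_component (- under_params D j) t (s + of_int k)"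
  shows "arc_through D j s \<subseteq> arc_through D j t"
proof
  fix p assume "p \<in> arc_through D j s"
  then obtain r l where r: "p = (j, r)" "connected_component (- under_params D j) s (r + of_int l)"
    by (auto simp: arc_through_def)
  have "connected_component (- under_params D j) (s + of_int k) (r + of_int (l + k))"
    using connected_params_add_int[OF j r(2), of k] by (simp add: add.assoc)
  then show "p \<in> arc_through D j t"
    using r(1) c unfolding arc_through_def by (blast intro: connected_component_trans)
qed

lemma arc_through_eqI:
  assumes j: "j < ncomp D" and c: "connected_component (- under_params D j) t (s + of_int k)"
  shows "arc_through D j s = arc_through D j t"
proof
  show "arc_through D j s \<subseteq> arc_through D j t" by (rule arc_through_subset[OF assms])
  have "connected_component (- under_params D j) s (t + of_int (- k))"
    using connected_params_add_int[OF j connected_component_sym[OF c], of "- k"] by simp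
  then show "arc_through D j t \<subseteq> arc_through D j s" by (rule arc_through_subset[OF j])
qed

lemma arc_through_self: "t \<notin> under_params D j \<Longrightarrow> (j, t) \<in> arc_through D j t"
  by (auto simp: arc_through_def intro!: exI[of _ "0::int"])

text \<open>Arcs are classes of an equivalence relation on parameters, so one parameter determines
  its arc; this resolves the descriptions of the arcs at a crossing.\<close>

lemma arc_unique:
  assumes "A \<in> arcs D" "(j, s) \<in> A"
  shows "j < ncomp D" "s \<notin> under_params D j" "A = arc_through D j s"
proof -
  obtain j' t where A: "A = arc_through D j' t" "j' < ncomp D" using assms(1) by (auto simp: arcs_def)
  then obtain k where "j' = j" and k: "connected_component (- under_params D j) t (s + of_int k)"
    using assms(2) by (auto simp: arc_through_def)
  then show j: "j < ncomp D" and "A = arc_through D j s"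
    using A arc_through_eqI by auto
  show "s \<notin> under_params D j"
    using connected_component_in[OF k] under_params_add_int[OF j] by auto
qed

lemma arc_through_add_1:
  assumes j: "j < ncomp D" and t: "t \<notin> under_params D j"
  shows "arc_through D j (t + 1) = arc_through D j t"
  by (rule arc_through_eqI[OF j, of _ _ "- 1"]) (use t in simp)

lemma arc_through_interval:
  assumes j: "j < ncomp D" and I: "connected I" "I \<inter> under_params D j = {}" "t \<in> I" "s \<in> I"
  shows "arc_through D j s = arc_through D j t"
  by (rule arc_through_eqI[OF j, of _ _ 0]) (use I in \<open>auto simp: connected_component_def\<close>)

lemma arc_through_locally_constant:
  assumes j: "j < ncomp D" and t: "t \<notin> under_params D j"
  shows "eventually (\<lambda>s. arc_through D j s = arc_through D j t) (at t)"
proof -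
  have "eventually (\<lambda>s. s \<notin> under_params D j) (at t)"
    using eventually_not_crossing[OF j] by eventually_elim (rule not_crossing_not_under_params)
  then obtain d where d: "d > 0" "\<And>s. s \<noteq> t \<Longrightarrow> dist s t < d \<Longrightarrow> s \<notin> under_params D j"
    unfolding eventually_at by blast
  have "s \<notin> under_params D j" if "s \<in> ball t d" for s
    using d(2)[of s] t that by (cases "s = t") (auto simp: dist_commute)
  then have "ball t d \<inter> under_params D j = {}" by blast
  then have "arc_through D j s = arc_through D j t" if "dist s t < d" for s
    using d(1) that by (intro arc_through_interval[OF j, of "ball t d"]) (auto simp: dist_commute)
  then show ?thesis using d(1) unfolding eventually_at by blast
qed

text \<open>A punctured neighbourhood of \<open>t\<close> contains no undercrossing even if
  \<open>t\<close> is one, and each half of it is an interval.\<close>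

lemma arc_through_one_sided:
  assumes j: "j < ncomp D"
  shows "\<exists>A\<in>arcs D. eventually (\<lambda>s. s \<notin> under_params D j \<and> arc_through D j s = A) (at_left t)"
    and "\<exists>A\<in>arcs D. eventually (\<lambda>s. s \<notin> under_params D j \<and> arc_through D j s = A) (at_right t)"
proof -
  have "eventually (\<lambda>s. s \<notin> under_params D j) (at t)"
    using eventually_not_crossing[OF j] by eventually_elim (rule not_crossing_not_under_params)
  then obtain d where d: "d > 0" "\<And>s. s \<noteq> t \<Longrightarrow> dist s t < d \<Longrightarrow> s \<notin> under_params D j"
    unfolding eventually_at by blast
  have const: "s \<notin> under_params D j \<and> arc_through D j s = arc_through D j r"
    if "connected I" "I \<subseteq> ball t d - {t}" "r \<in> I" "s \<in> I" for I r s
  proof -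
    have "r' \<notin> under_params D j" if "r' \<in> I" for r'
    proof (rule d(2))
      have "r' \<in> ball t d - {t}" using that \<open>I \<subseteq> _\<close> by blast
      then show "r' \<noteq> t" "dist r' t < d" by (auto simp: dist_commute)
    qed
    then have "I \<inter> under_params D j = {}" by blast
    then show ?thesis using that arc_through_interval[OF j that(1)] by blast
  qed
  have arc: "arc_through D j r \<in> arcs D" if "r \<noteq> t" "dist r t < d" for r
    using j d(2)[OF that] by (auto simp: arcs_def)
  have "eventually (\<lambda>s. s \<in> {t - d<..<t}) (at_left t)" using d(1) by (intro eventually_at_left_real) simp
  then have "eventually (\<lambda>s. s \<notin> under_params D j \<and> arc_through D j s = arc_through D j (t - d / 2)) (at_left t)"
    by eventually_elim (rule const[of "{t - d<..<t}"]; use d(1) in \<open>auto simp: dist_real_def\<close>)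
  then show "\<exists>A\<in>arcs D. eventually (\<lambda>s. s \<notin> under_params D j \<and> arc_through D j s = A) (at_left t)"
    using d(1) by (intro bexI[OF _ arc]) (auto simp: dist_real_def)
  have "eventually (\<lambda>s. s \<in> {t<..<t + d}) (at_right t)" using d(1) by (intro eventually_at_right_real) simp
  then have "eventually (\<lambda>s. s \<notin> under_params D j \<and> arc_through D j s = arc_through D j (t + d / 2)) (at_right t)"
    by eventually_elim (rule const[of "{t<..<t + d}"]; use d(1) in \<open>auto simp: dist_real_def\<close>)
  then show "\<exists>A\<in>arcs D. eventually (\<lambda>s. s \<notin> under_params D j \<and> arc_through D j s = A) (at_right t)"
    using d(1) by (intro bexI[OF _ arc]) (auto simp: dist_real_def)
qed

lemma the_arc_eventually:
  assumes F: "F \<noteq> bot" and A: "A \<in> arcs D"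
    and ev: "eventually (\<lambda>s. s \<notin> under_params D j \<and> arc_through D j s = A) F"
  shows "(THE a. a \<in> arcs D \<and> eventually (\<lambda>s. (j, s) \<in> a) F) = A"
proof (rule the_equality)
  show "A \<in> arcs D \<and> eventually (\<lambda>s. (j, s) \<in> A) F"
    using A ev by (auto elim!: eventually_mono dest: arc_through_self)
  fix B assume B: "B \<in> arcs D \<and> eventually (\<lambda>s. (j, s) \<in> B) F"
  then have "eventually (\<lambda>s. (j, s) \<in> B) F" by blast
  with ev have "eventually (\<lambda>s. (j, s) \<in> B \<and> arc_through D j s = A) F" by eventually_elim simp
  then obtain s where "(j, s) \<in> B" "arc_through D j s = A" using eventually_happens'[OF F] by blast
  then show "B = A" using arc_unique(3) B by blast
qed

lemma under_arcs:
  assumes x: "x \<in> crossings D" and under: "under D x = (j, t)"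
  shows "incoming_under_arc D x \<in> arcs D" "outgoing_under_arc D x \<in> arcs D"
    and "eventually (\<lambda>s. arc_through D j s = incoming_under_arc D x) (at_left t)"
    and "eventually (\<lambda>s. arc_through D j s = outgoing_under_arc D x) (at_right t)"
proof -
  have j: "j < ncomp D" using strands_crossing(1)[OF x] under strandsD(1) by auto
  obtain A where A: "A \<in> arcs D" "eventually (\<lambda>s. s \<notin> under_params D j \<and> arc_through D j s = A) (at_left t)"
    using arc_through_one_sided(1)[OF j] by blast
  have "incoming_under_arc D x = A"
    unfolding incoming_under_arc_def under prod.case
    by (rule the_arc_eventually[OF _ A]) simp
  then show "incoming_under_arc D x \<in> arcs D" "eventually (\<lambda>s. arc_through D j s = incoming_under_arc D x) (at_left t)"
    using A by (auto elim: eventually_mono)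
  obtain B where B: "B \<in> arcs D" "eventually (\<lambda>s. s \<notin> under_params D j \<and> arc_through D j s = B) (at_right t)"
    using arc_through_one_sided(2)[OF j] by blast
  have "outgoing_under_arc D x = B"
    unfolding outgoing_under_arc_def under prod.case
    by (rule the_arc_eventually[OF _ B]) simp
  then show "outgoing_under_arc D x \<in> arcs D" "eventually (\<lambda>s. arc_through D j s = outgoing_under_arc D x) (at_right t)"
    using B by (auto elim: eventually_mono)
qed

text \<open>At a crossing the over-strand differs from the under-strand, so its parameter is not an
  undercrossing and one arc continues through it.\<close>

lemma over_arc:
  assumes x: "x \<in> crossings D" and over: "over D x = (j, t)"
  shows "over_arc D x \<in> arcs D" "eventually (\<lambda>s. arc_through D j s = over_arc D x) (at t)"
proof -
  have p: "(j, t) \<in> strands D x" using over_in_strands[OF x] over by simp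
  note j = strandsD[OF p]
  have "frac t = t" using j by (simp add: frac_eq)
  then have t: "t \<notin> under_params D j"
    using strands_crossing(2)[OF x] over j(4) by (auto simp: under_params_def)
  have A: "arc_through D j t \<in> arcs D" using j t by (auto simp: arcs_def)
  have "over_arc D x = arc_through D j t"
    unfolding over_arc_def over
    using A arc_through_self[OF t] arc_unique(3) by (intro the_equality) blast+
  then show "over_arc D x \<in> arcs D" "eventually (\<lambda>s. arc_through D j s = over_arc D x) (at t)"
    using A arc_through_locally_constant[OF j(1) t] by simp_all
qed

end


section \<open>Telescoping the coboundary\<close>

lemma the_eventual_value:
  assumes "F \<noteq> bot" and ev: "eventually (\<lambda>s. f s = v) F"
  shows "(THE v. eventually (\<lambda>s. f s = v) F) = v"
proof (rule the_equality, rule ev)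
  fix w assume "eventually (\<lambda>s. f s = w) F"
  with ev have "eventually (\<lambda>s. w = v) F" by eventually_elim simp
  then show "w = v" using assms(1) by (simp add: eventually_const)
qed

lemma unit_power_int_add_1:
  assumes "(\<alpha> :: 'r::comm_ring_1) dvd 1"
  shows "unit_power_int \<alpha> (k + 1) = \<alpha> * unit_power_int \<alpha> k"
proof -
  obtain \<beta> where \<beta>: "\<alpha> * \<beta> = 1" using assms by (metis dvdE)
  have "(THE \<beta>. \<alpha> * \<beta> = 1) = \<beta>"
  proof (rule the_equality, rule \<beta>)
    fix \<gamma> assume "\<alpha> * \<gamma> = 1"
    then have "\<beta> * (\<alpha> * \<gamma>) = \<beta>" by simp
    then have "(\<alpha> * \<beta>) * \<gamma> = \<beta>" by (simp only: mult_ac)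
    then show "\<gamma> = \<beta>" using \<beta> by simp
  qed
  then have u: "unit_power_int \<alpha> k = (if 0 \<le> k then \<alpha> ^ nat k else \<beta> ^ nat (- k))" for k
    by (simp add: unit_power_int_def)
  \<comment> \<open>Only for k = -1 do \<open>k\<close> and \<open>k + 1\<close> fall into different
    branches of the definition.\<close>
  consider "k \<ge> 0" | "k = - 1" | "k < - 1" by linarith
  then show ?thesis
  proof cases
    case 1
    then have "nat (k + 1) = Suc (nat k)" by simp
    then show ?thesis using 1 by (simp add: u)
  next
    case 2
    then show ?thesis using \<beta> by (simp add: u)
  next
    case 3
    then have "nat (- k) = Suc (nat (- (k + 1)))" by simp
    then have "\<alpha> * \<beta> ^ nat (- k) = (\<alpha> * \<beta>) * \<beta> ^ nat (- (k + 1))" by (simp only: power_Suc mult.assoc)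
    then show ?thesis using 3 \<beta> by (simp add: u)
  qed
qed

context link_diagram
begin

text \<open>The strands at all crossings are the same pairs as the components with their crossing
  parameters. Regrouped by component, the jumps around each closed curve cancel.\<close>

lemma sum_strand_jumps:
  fixes f :: "nat \<Rightarrow> real \<Rightarrow> 'b::ab_group_add"
  assumes per: "\<And>j t. j < ncomp D \<Longrightarrow> curve D j t \<notin> crossings D \<Longrightarrow> f j (t + 1) = f j t"
    and const: "\<And>j t. j < ncomp D \<Longrightarrow> 0 \<le> t \<Longrightarrow> t < 1 \<Longrightarrow> curve D j t \<notin> crossings D \<Longrightarrow>
      eventually (\<lambda>s. f j s = f j t) (at t)"
    and left: "\<And>x j t. x \<in> crossings D \<Longrightarrow> (j, t) \<in> strands D x \<Longrightarrow> eventually (\<lambda>s. f j s = L (j, t)) (at_left t)"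
    and right: "\<And>x j t. x \<in> crossings D \<Longrightarrow> (j, t) \<in> strands D x \<Longrightarrow> eventually (\<lambda>s. f j s = R (j, t)) (at_right t)"
  shows "(\<Sum>x\<in>crossings D. \<Sum>p\<in>strands D x. L p - R p) = 0"
proof -
  define T where "T j = {t. 0 \<le> t \<and> t < 1 \<and> curve D j t \<in> crossings D}" for j
  have S: "(\<Union>x\<in>crossings D. strands D x) = Sigma {..<ncomp D} T"
    by (auto simp: strands_def T_def)
  have "finite (Sigma {..<ncomp D} T)"
    unfolding S[symmetric] using finite_crossings finite_strands by auto
  have finT: "finite (T j)" if "j < ncomp D" for j
  proof -
    have "T j \<subseteq> snd ` Sigma {..<ncomp D} T" using that by force
    then show ?thesis using \<open>finite (Sigma _ _)\<close> finite_subset by blast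
  qed
  have "(\<Sum>x\<in>crossings D. \<Sum>p\<in>strands D x. L p - R p) = (\<Sum>p\<in>(\<Union>x\<in>crossings D. strands D x). L p - R p)"
    using finite_crossings finite_strands
    by (intro sum.UNION_disjoint[symmetric]) (auto simp: strands_def)
  also have "\<dots> = (\<Sum>j<ncomp D. \<Sum>t\<in>T j. L (j, t) - R (j, t))"
    unfolding S using finT by (subst sum.Sigma) (auto simp: case_prod_unfold)
  also have "\<dots> = 0"
  proof (rule sum.neutral, rule ballI)
    fix j assume "j \<in> {..<ncomp D}"
    then have j: "j < ncomp D" by simp
    have strand: "(j, t) \<in> strands D (curve D j t)" "curve D j t \<in> crossings D" if "t \<in> T j" for t
      using that j by (auto simp: T_def strands_def)
    \<comment> \<open>Periodicity of \<open>f\<close> is given only off the crossings. The value 0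
      there makes \<open>g\<close> periodic everywhere and leaves the one-sided limits
      unchanged.\<close>
    define g where "g t = (if curve D j t \<in> crossings D then 0 else f j t)" for t
    have gf: "eventually (\<lambda>s. g s = f j s) (at t)" for t
      using eventually_not_crossing[OF j] by eventually_elim (simp add: g_def)
    then have gl: "eventually (\<lambda>s. g s = f j s) (at_left t)" and gr: "eventually (\<lambda>s. g s = f j s) (at_right t)" for t
      by (simp_all add: eventually_at_split)
    show "(\<Sum>t\<in>T j. L (j, t) - R (j, t)) = 0"
    proof (rule sum_of_jumps_periodic[of g _ "\<lambda>t. L (j, t)" "\<lambda>t. R (j, t)"])
      show "g (t + 1) = g t" for t using per[OF j, of t] curve_add_1[OF j, of t] by (simp add: g_def)
      show "T j \<subseteq> {0..<1}" by (auto simp: T_def)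
      fix t assume t: "t \<in> {0..<1} - T j"
      then have t': "0 \<le> t" "t < 1" "curve D j t \<notin> crossings D" by (auto simp: T_def)
      show "eventually (\<lambda>s. g s = g t) (at t)"
        using gf[of t] const[OF j t'] by eventually_elim (use t'(3) in \<open>simp add: g_def\<close>)
    next
      fix t assume t: "t \<in> T j"
      show "eventually (\<lambda>s. g s = L (j, t)) (at_left t)"
        using gl[of t] left[OF strand(2,1)[OF t]] by eventually_elim simp
      show "eventually (\<lambda>s. g s = R (j, t)) (at_right t)"
        using gr[of t] right[OF strand(2,1)[OF t]] by eventually_elim simp
    qed (rule finT[OF j])
  qed
  finally show ?thesis .
qed

lemma twisted_weight_cohomologous:
  fixes s :: "'r::comm_ring_1 \<Rightarrow> 'a::ab_group_add \<Rightarrow> 'a"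
  assumes "module s" and \<alpha>: "\<alpha> dvd 1" and C: "C \<in> colorings Q lhd D"
    and \<theta>: "\<And>a b. a \<in> Q \<Longrightarrow> b \<in> Q \<Longrightarrow>
      \<omega> a b - \<omega>' a b = s (1 - \<alpha>) (\<theta> b) - \<theta> (lhd a b) + s \<alpha> (\<theta> a)"
  shows "twisted_weight s \<omega> D C \<alpha> = twisted_weight s \<omega>' D C \<alpha>"
proof -
  interpret module s by fact
  \<comment> \<open>The exponent is normalised so that, with q = \<alpha>^(-n), the index n + 1
    gives q and the index n gives q \<alpha>. These are the factors of \<theta> in the coboundary:
    the under-strand supplies the terms in \<open>a\<close> and \<open>lhd a b\<close>, and the two
    sides of the over-strand supply 1 - \<alpha>.\<close>
  define P where "P k c = s (unit_power_int \<alpha> (1 - k)) (\<theta> c)" for k c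
  define f where "f j t = P (right_index j t) (C (arc_through D j t))" for j t
  \<comment> \<open>The limits are named as functions of the strand alone, in the form needed for
    the sum over all strands; their values are computed crossing by crossing.\<close>
  define L where "L p = (THE v. eventually (\<lambda>t. f (fst p) t = v) (at_left (snd p)))" for p
  define R where "R p = (THE v. eventually (\<lambda>t. f (fst p) t = v) (at_right (snd p)))" for p
  have lim: "eventually (\<lambda>t. f j t = P k (C A)) F"
    if "eventually (\<lambda>t. right_index j t = k) F" "eventually (\<lambda>t. arc_through D j t = A) F" for F j k A
    using that by eventually_elim (simp add: f_def)
  have LI: "L (j, t) = v" if "eventually (\<lambda>t. f j t = v) (at_left t)" for j t v
    unfolding L_def using the_eventual_value[OF _ that] by simp
  have RI: "R (j, t) = v" if "eventually (\<lambda>t. f j t = v) (at_right t)" for j t v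
    unfolding R_def using the_eventual_value[OF _ that] by simp
  have cross: "s (of_int (crossing_sign D x) * unit_power_int \<alpha> (- crossing_index D x))
          (\<omega> (C (right_under_arc D x)) (C (over_arc D x))) -
        s (of_int (crossing_sign D x) * unit_power_int \<alpha> (- crossing_index D x))
          (\<omega>' (C (right_under_arc D x)) (C (over_arc D x))) = (\<Sum>p\<in>strands D x. L p - R p) \<and>
      (\<forall>(j, t)\<in>strands D x. eventually (\<lambda>s. f j s = L (j, t)) (at_left t) \<and> eventually (\<lambda>s. f j s = R (j, t)) (at_right t))"
    if x: "x \<in> crossings D" for x
  proof -
    obtain jo to where over: "over D x = (jo, to)" by force
    obtain ju tu where under: "under D x = (ju, tu)" by force
    note st = strands_crossing[OF x]
    define W where "W = wedge (tangent D (over D x)) (tangent D (under D x))"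
    define n where "n = crossing_index D x"
    define a b where "a = C (right_under_arc D x)" and "b = C (over_arc D x)"
    note ri = right_index_at_crossing[OF x over under, folded W_def n_def]
    note ua = under_arcs[OF x under] and oa = over_arc[OF x over]
    have oa': "eventually (\<lambda>s. arc_through D jo s = over_arc D x) (at_left to)"
      "eventually (\<lambda>s. arc_through D jo s = over_arc D x) (at_right to)"
      using oa(2) by (simp_all add: eventually_at_split)
    have "right_under_arc D x \<in> arcs D" using ua(1,2) by (simp add: right_under_arc_def)
    then have ab: "a \<in> Q" "b \<in> Q" using C oa(1) by (auto simp: colorings_def a_def b_def)
    have lhd: "C (left_under_arc D x) = lhd a b" using C x by (simp add: colorings_def a_def b_def)
    define q where "q = unit_power_int \<alpha> (- n)"
    have "unit_power_int \<alpha> (1 - n) = \<alpha> * q"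
      using unit_power_int_add_1[OF \<alpha>, of "- n"] by (simp add: q_def)
    then have P: "P n c = s q (s \<alpha> (\<theta> c))" "P (n + 1) c = s q (\<theta> c)" for c
      by (simp_all add: P_def q_def mult.commute)
    have key: "s q (\<omega> a b) - s q (\<omega>' a b) = P (n + 1) b - P n b + P n a - P (n + 1) (lhd a b)"
      using \<theta>[OF ab]
      \<comment> \<open>The first pass gathers differences under \<open>s q\<close>, where the
        cohomology equation applies; the second expands again.\<close>
      by (simp add: P scale_right_diff_distrib[symmetric] scale_left_diff_distrib)
         (simp add: scale_right_diff_distrib scale_right_distrib algebra_simps)
    have sum: "(\<Sum>p\<in>strands D x. L p - R p) = (L (jo, to) - R (jo, to)) + (L (ju, tu) - R (ju, tu))"
    proof -
      have "over D x \<notin> {under D x}" using st(2) by auto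
      then show ?thesis unfolding st(1) over[symmetric] under[symmetric]
        by (subst sum.insert) auto
    qed
    consider "W > 0" | "W < 0" using wedge_over_under[OF x] unfolding W_def by linarith
    then show ?thesis
    proof cases
      case 1
      have arcs: "right_under_arc D x = incoming_under_arc D x" "left_under_arc D x = outgoing_under_arc D x"
        using 1 by (simp_all add: right_under_arc_def left_under_arc_def right_of_def left_of_def W_def)
      have ev: "eventually (\<lambda>t. f jo t = P (n + 1) b) (at_left to)" "eventually (\<lambda>t. f jo t = P n b) (at_right to)"
        "eventually (\<lambda>t. f ju t = P n a) (at_left tu)" "eventually (\<lambda>t. f ju t = P (n + 1) (lhd a b)) (at_right tu)"
        unfolding lhd[symmetric] unfolding a_def b_def arcs
        using ri(1)[OF 1] ua(3,4) oa' by (auto intro: lim)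
      note LR = LI[OF ev(1)] RI[OF ev(2)] LI[OF ev(3)] RI[OF ev(4)]
      have "crossing_sign D x = 1" using 1 by (simp add: crossing_sign_def W_def)
      then show ?thesis
        unfolding sum a_def[symmetric] b_def[symmetric] n_def[symmetric] q_def[symmetric]
        using key ev st over under by (simp add: LR q_def[symmetric])
    next
      case 2
      have arcs: "right_under_arc D x = outgoing_under_arc D x" "left_under_arc D x = incoming_under_arc D x"
        using 2 by (simp_all add: right_under_arc_def left_under_arc_def right_of_def left_of_def W_def)
      have ev: "eventually (\<lambda>t. f jo t = P n b) (at_left to)" "eventually (\<lambda>t. f jo t = P (n + 1) b) (at_right to)"
        "eventually (\<lambda>t. f ju t = P (n + 1) (lhd a b)) (at_left tu)" "eventually (\<lambda>t. f ju t = P n a) (at_right tu)"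
        unfolding lhd[symmetric] unfolding a_def b_def arcs
        using ri(2)[OF 2] ua(3,4) oa' by (auto intro: lim)
      note LR = LI[OF ev(1)] RI[OF ev(2)] LI[OF ev(3)] RI[OF ev(4)]
      have "crossing_sign D x = - 1" using 2 by (simp add: crossing_sign_def W_def)
      \<comment> \<open>At a negative crossing before and after are exchanged on both strands, so
        every jump changes sign together with the weight.\<close>
      moreover have "- s q (\<omega> a b) + s q (\<omega>' a b) = P n b - P (n + 1) b + (P (n + 1) (lhd a b) - P n a)"
        using arg_cong[OF key, of uminus] by (simp add: algebra_simps)
      ultimately show ?thesis
        unfolding sum a_def[symmetric] b_def[symmetric] n_def[symmetric] q_def[symmetric]
        using ev st over under by (simp add: LR q_def[symmetric])
    qed
  qed
  have "twisted_weight s \<omega> D C \<alpha> - twisted_weight s \<omega>' D C \<alpha> = (\<Sum>x\<in>crossings D. \<Sum>p\<in>strands D x. L p - R p)"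
    unfolding twisted_weight_def sum_subtractf[symmetric] using cross by (intro sum.cong) auto
  also have "\<dots> = 0"
  proof (rule sum_strand_jumps[of f])
    fix j t assume j: "j < ncomp D" and t: "curve D j t \<notin> crossings D"
    show "f j (t + 1) = f j t"
      using right_index_add_1[OF j] arc_through_add_1[OF j not_crossing_not_under_params[OF t]]
      by (simp add: f_def)
  next
    fix j t assume j: "j < ncomp D" and t: "0 \<le> t" "t < 1" "curve D j t \<notin> crossings D"
    show "eventually (\<lambda>s. f j s = f j t) (at t)"
      unfolding f_def[of j t]
      using right_index_locally_constant[OF j t]
        arc_through_locally_constant[OF j not_crossing_not_under_params[OF t(3)]] by (rule lim)
  next
    fix x j t assume "x \<in> crossings D" "(j, t) \<in> strands D x"
    then show "eventually (\<lambda>s. f j s = L (j, t)) (at_left t)" "eventually (\<lambda>s. f j s = R (j, t)) (at_right t)"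
      using cross by auto
  qed
  finally show ?thesis by simp
qed

end

theorem proposition4p2:
  fixes Q :: "'q set"
    and lhd lhd_inv :: "'q \<Rightarrow> 'q \<Rightarrow> 'q"
    and s :: "'r::comm_ring_1 \<Rightarrow> 'a::ab_group_add \<Rightarrow> 'a"
    and \<alpha> :: 'r
    and \<omega> \<omega>' :: "'q \<Rightarrow> 'q \<Rightarrow> 'a"
  assumes "quandle Q lhd lhd_inv"
    and "module s"
    and "\<alpha> dvd 1"
    and "twisted_cocycle Q lhd s \<alpha> \<omega>"
    and "twisted_cocycle Q lhd s \<alpha> \<omega>'"
    and "cohomologous Q lhd s \<alpha> \<omega> \<omega>'"
  shows "(\<forall>D C. knot_diagram D \<and> C \<in> colorings Q lhd D \<longrightarrow>
            twisted_weight s \<omega> D C \<alpha> = twisted_weight s \<omega>' D C \<alpha>) \<and>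
         (\<forall>D. knot_diagram D \<longrightarrow>
            same_multiset (colorings Q lhd D) (\<lambda>C. twisted_weight s \<omega> D C \<alpha>)
                          (colorings Q lhd D) (\<lambda>C. twisted_weight s \<omega>' D C \<alpha>))"
proof -
  obtain \<theta> where \<theta>: "\<And>a b. a \<in> Q \<Longrightarrow> b \<in> Q \<Longrightarrow>
      \<omega> a b - \<omega>' a b = s (1 - \<alpha>) (\<theta> b) - \<theta> (lhd a b) + s \<alpha> (\<theta> a)"
    using assms(6) unfolding cohomologous_def by blast
  have eq: "twisted_weight s \<omega> D C \<alpha> = twisted_weight s \<omega>' D C \<alpha>"
    if "knot_diagram D" "C \<in> colorings Q lhd D" for D C
  proof -
    interpret link_diagram D by unfold_locales fact
    show ?thesis by (rule twisted_weight_cohomologous[OF assms(2,3) that(2) \<theta>])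
  qed
  moreover have "same_multiset (colorings Q lhd D) (\<lambda>C. twisted_weight s \<omega> D C \<alpha>)
      (colorings Q lhd D) (\<lambda>C. twisted_weight s \<omega>' D C \<alpha>)" if "knot_diagram D" for D
  proof -
    have "{C \<in> colorings Q lhd D. twisted_weight s \<omega> D C \<alpha> = w} =
        {C \<in> colorings Q lhd D. twisted_weight s \<omega>' D C \<alpha> = w}" for w
      using eq[OF that] by auto
    then show ?thesis by (simp add: same_multiset_def)
  qed
  ultimately show ?thesis by blast
qed

end
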